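(* Let $\mathcal M$ be the Fraïssé limit of a free amalgamation class in a relational language, and suppose that $\mathcal M$ is not an indiscernible set. If $\mathrm{Aut}(\mathcal M)$ acts transitively on $\mathcal M$, then $\mathrm{Aut}(\mathcal M)$ is simple. Moreover, for any nontrivial $g\in\mathrm{Aut}(\mathcal M)$, every element of $\mathrm{Aut}(\mathcal M)$ can be written as a product of at most $16$ conjugates of $g$ and $g^{-1}$.
   Context: Let $L$ be a relational language. A free amalgamation class is a class $\mathcal C$ of finite $L$-structures, containing only countably many structures up to isomorphism, closed under isomorphism and (induced) substructures, and such that for all $A,C\in\mathcal C$ with common substructure $B=A\cap C$ (possibly empty) the free amalgam $A\otimes_B C$ belongs to $\mathcal C$; here $A\otimes_B C$ is the structure on the set $A\cup C$ extending $A$ and $C$ such that whenever $R(d_1,\dots,d_n)$ holds for $d_1,\dots,d_n\in A\cup C$ then either all $d_i$ lie in $A$ or all $d_i$ lie in $C$. The Fraïssé limit of $\mathcal C$ is the (unique) countable structure $\mathcal M$ whose finite substructures are, up to isomorphism, exactly the elements of $\mathcal C$ and such that any isomorphism between finite substructures extends to an automorphism of $\mathcal M$. $\mathcal M$ is an indiscernible set if $\mathrm{Aut}(\mathcal M)$ is the full symmetric group of the underlying set of $\mathcal M$. *)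

theory Defs
  imports "HOL-Algebra.Algebra" "HOL-Library.Countable_Set"
begin

text \<open>
  A relational language is a set \<open>L\<close> of relation symbols with an arity function \<open>ar\<close>. It may be
  empty or uncountable. A tuple is a list, and relations are only allowed to hold for
  symbols of \<open>L\<close> and tuples of the right length over the carrier, so that equality of records is
  equality of structures. Structures may be empty.
\<close>

record ('a, 'r) relstr = "'a partial_object" +
  rel :: "'r \<Rightarrow> 'a list \<Rightarrow> bool"

definition structure_for :: "'r set \<Rightarrow> ('r \<Rightarrow> nat) \<Rightarrow> ('a, 'r) relstr \<Rightarrow> bool" where
  "structure_for L ar A \<longleftrightarrow>
     (\<forall>R xs. rel A R xs \<longrightarrow> R \<in> L \<and> length xs = ar R \<and> set xs \<subseteq> carrier A)"

definition induced :: "('a, 'r) relstr \<Rightarrow> 'a set \<Rightarrow> ('a, 'r) relstr" where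
  "induced A S = \<lparr>carrier = S, rel = (\<lambda>R xs. set xs \<subseteq> S \<and> rel A R xs)\<rparr>"

definition substructure :: "('a, 'r) relstr \<Rightarrow> ('a, 'r) relstr \<Rightarrow> bool" where
  "substructure B A \<longleftrightarrow> carrier B \<subseteq> carrier A \<and> B = induced A (carrier B)"

definition struct_iso :: "('a \<Rightarrow> 'b) \<Rightarrow> ('a, 'r) relstr \<Rightarrow> ('b, 'r) relstr \<Rightarrow> bool" where
  "struct_iso f A B \<longleftrightarrow> bij_betw f (carrier A) (carrier B) \<and>
     (\<forall>R xs. set xs \<subseteq> carrier A \<longrightarrow> rel A R xs = rel B R (map f xs))"

definition isomorphic :: "('a, 'r) relstr \<Rightarrow> ('b, 'r) relstr \<Rightarrow> bool" where
  "isomorphic A B \<longleftrightarrow> (\<exists>f. struct_iso f A B)"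

text \<open>\<open>free_amalgam L ar A C D\<close>: \<open>D\<close> is the free amalgam of \<open>A\<close> and \<open>C\<close> over \<open>A \<inter> C\<close>.\<close>

definition free_amalgam ::
  "'r set \<Rightarrow> ('r \<Rightarrow> nat) \<Rightarrow> ('a, 'r) relstr \<Rightarrow> ('a, 'r) relstr \<Rightarrow> ('a, 'r) relstr \<Rightarrow> bool" where
  "free_amalgam L ar A C D \<longleftrightarrow>
     structure_for L ar D \<and> carrier D = carrier A \<union> carrier C \<and>
     substructure A D \<and> substructure C D \<and>
     (\<forall>R ds. rel D R ds \<longrightarrow> set ds \<subseteq> carrier A \<or> set ds \<subseteq> carrier C)"

text \<open>
  A class of finite structures closed under isomorphism is represented by its members with carrier
  a set of natural numbers; every finite structure, and every pair \<open>A, C\<close> of finite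
  structures, has an isomorphic copy of this form.
\<close>

definition free_amalgamation_class ::
  "'r set \<Rightarrow> ('r \<Rightarrow> nat) \<Rightarrow> (nat, 'r) relstr set \<Rightarrow> bool" where
  "free_amalgamation_class L ar \<C> \<longleftrightarrow>
     (\<forall>A\<in>\<C>. structure_for L ar A \<and> finite (carrier A)) \<and>
     (\<exists>\<D>\<subseteq>\<C>. countable \<D> \<and> (\<forall>A\<in>\<C>. \<exists>B\<in>\<D>. isomorphic A B)) \<and>
     (\<forall>A\<in>\<C>. \<forall>B. structure_for L ar B \<and> isomorphic A B \<longrightarrow> B \<in> \<C>) \<and>
     (\<forall>A\<in>\<C>. \<forall>B. substructure B A \<longrightarrow> B \<in> \<C>) \<and>
     (\<forall>A\<in>\<C>. \<forall>C\<in>\<C>.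
        induced A (carrier A \<inter> carrier C) = induced C (carrier A \<inter> carrier C) \<longrightarrow>
        (\<exists>D\<in>\<C>. free_amalgam L ar A C D))"

text \<open>As in \<open>BijGroup\<close>, automorphisms are extensional functions on the carrier.\<close>

definition Aut :: "('a, 'r) relstr \<Rightarrow> ('a \<Rightarrow> 'a) monoid" where
  "Aut M = BijGroup (carrier M) \<lparr>carrier := {f \<in> Bij (carrier M). struct_iso f M M}\<rparr>"

definition fraisse_limit ::
  "'r set \<Rightarrow> ('r \<Rightarrow> nat) \<Rightarrow> (nat, 'r) relstr set \<Rightarrow> ('a, 'r) relstr \<Rightarrow> bool" where
  "fraisse_limit L ar \<C> M \<longleftrightarrow>
     structure_for L ar M \<and> countable (carrier M) \<and>
     (\<forall>B. substructure B M \<and> finite (carrier B) \<longrightarrow> (\<exists>A\<in>\<C>. isomorphic A B)) \<and>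
     (\<forall>A\<in>\<C>. \<exists>B. substructure B M \<and> finite (carrier B) \<and> isomorphic A B) \<and>
     (\<forall>B B' f. substructure B M \<and> finite (carrier B) \<and>
        substructure B' M \<and> finite (carrier B') \<and> struct_iso f B B' \<longrightarrow>
        (\<exists>g\<in>carrier (Aut M). \<forall>x\<in>carrier B. g x = f x))"

definition indiscernible_set :: "('a, 'r) relstr \<Rightarrow> bool" where
  "indiscernible_set M \<longleftrightarrow> Aut M = BijGroup (carrier M)"

text \<open>
  The locale \<open>simple_group\<close> of HOL-Algebra requires \<open>order G > 1\<close> and hence only covers
  finite groups, as \<open>order G = 0\<close> for infinite \<open>G\<close>.
\<close>

definition is_simple :: "('g, 'm) monoid_scheme \<Rightarrow> bool" where
  "is_simple G \<longleftrightarrow> group G \<and> carrier G \<noteq> {\<one>\<^bsub>G\<^esub>} \<and>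
     (\<forall>N. N \<lhd> G \<longrightarrow> N = carrier G \<or> N = {\<one>\<^bsub>G\<^esub>})"

definition conjugates :: "('g, 'm) monoid_scheme \<Rightarrow> 'g \<Rightarrow> 'g set" where
  "conjugates G g = {k \<otimes>\<^bsub>G\<^esub> g \<otimes>\<^bsub>G\<^esub> inv\<^bsub>G\<^esub> k | k. k \<in> carrier G}"

text \<open>\<open>Aut M\<close> is a group, acting on the carrier by evaluation.\<close>

lemma struct_iso_inv:
  assumes "f \<in> Bij (carrier M)" "struct_iso f M M"
  shows "struct_iso (restrict (inv_into (carrier M) f) (carrier M)) M M"
proof -
  let ?S = "carrier M"
  let ?g = "restrict (inv_into ?S f) ?S"
  have bij: "bij_betw f ?S ?S" using assms by (simp add: Bij_def)
  have gb: "bij_betw ?g ?S ?S"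
    using restrict_inv_into_Bij[OF assms(1)] by (simp add: Bij_def)
  have "rel M R xs = rel M R (map ?g xs)" if xs: "set xs \<subseteq> ?S" for R xs
  proof -
    have "set (map ?g xs) \<subseteq> ?S" using xs gb by (auto simp: bij_betw_def)
    then have "rel M R (map ?g xs) = rel M R (map f (map ?g xs))"
      using assms(2) unfolding struct_iso_def by blast
    also have "map f (map ?g xs) = xs"
      using xs bij by (auto simp: bij_betw_def f_inv_into_f subset_iff intro!: map_idI)
    finally show ?thesis by (rule sym)
  qed
  with gb show ?thesis by (simp add: struct_iso_def)
qed

lemma struct_iso_compose:
  assumes "f \<in> Bij (carrier M)" "struct_iso f M M" "g \<in> Bij (carrier M)" "struct_iso g M M"
  shows "struct_iso (compose (carrier M) g f) M M"
proof -
  let ?S = "carrier M"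
  have "rel M R xs = rel M R (map (compose ?S g f) xs)" if xs: "set xs \<subseteq> ?S" for R xs
  proof -
    have "set (map f xs) \<subseteq> ?S" using xs assms(1) by (auto simp: Bij_def bij_betw_def)
    then have "rel M R xs = rel M R (map g (map f xs))"
      using assms(2,4) xs unfolding struct_iso_def by blast
    also have "map g (map f xs) = map (compose ?S g f) xs"
      using xs by (auto simp: compose_def subset_iff)
    finally show ?thesis .
  qed
  moreover have "bij_betw (compose ?S g f) ?S ?S"
    using compose_Bij[OF assms(3,1)] by (simp add: Bij_def)
  ultimately show ?thesis by (simp add: struct_iso_def)
qed

lemma subgroup_Aut: "subgroup (carrier (Aut M)) (BijGroup (carrier M))"
proof -
  let ?B = "BijGroup (carrier M)"
  interpret B: group ?B by (rule group_BijGroup)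
  have one: "(\<lambda>x\<in>carrier M. x) \<in> carrier (Aut M)"
  proof -
    have "map (\<lambda>x\<in>carrier M. x) xs = xs" if "set xs \<subseteq> carrier M" for xs
      using that by (auto intro!: map_idI)
    then show ?thesis
      using id_Bij[of "carrier M"] by (auto simp: Aut_def struct_iso_def Bij_def)
  qed
  show ?thesis
  proof (rule B.subgroupI)
    show "carrier (Aut M) \<subseteq> carrier ?B" by (auto simp: Aut_def BijGroup_def)
    show "carrier (Aut M) \<noteq> {}" using one by blast
    show "inv\<^bsub>?B\<^esub> f \<in> carrier (Aut M)" if "f \<in> carrier (Aut M)" for f
      using that by (auto simp: Aut_def inv_BijGroup restrict_inv_into_Bij struct_iso_inv)
    show "f \<otimes>\<^bsub>?B\<^esub> g \<in> carrier (Aut M)" if "f \<in> carrier (Aut M)" "g \<in> carrier (Aut M)" for f g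
      using that by (auto simp: Aut_def BijGroup_def compose_Bij struct_iso_compose)
  qed
qed

lemma group_Aut: "group (Aut M)"
  using subgroup.subgroup_is_group[OF subgroup_Aut group_BijGroup, of M]
  by (simp add: Aut_def)

lemma group_action_Aut: "group_action (Aut M) (carrier M) (\<lambda>g. g)"
proof -
  have "(\<lambda>g. g) \<in> hom (Aut M) (BijGroup (carrier M))"
    by (auto simp: hom_def Aut_def BijGroup_def)
  then show ?thesis
    by (simp add: group_action_def group_hom_def group_hom_axioms_def group_Aut group_BijGroup)
qed

end

theory Submission
  imports Defs "HOL-Combinatorics.Permutations"
begin

text \<open>
  The argument follows Tent and Ziegler, with finite sets in place of tuples and orbits of pointwise
  stabilizers in place of types. Write \<open>A \<bottom>\<^bsub>B\<^esub> C\<close> if \<open>A \<union> B \<union> C\<close> is the free amalgam of \<open>A \<union> B\<close>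
  and \<open>B \<union> C\<close> over \<open>B\<close>; this is a stationary independence relation. Suppose that \<open>f\<close> moves almost
  maximally: every type over every \<open>B\<close> has a realisation \<open>A\<close> with \<open>A \<bottom>\<^bsub>B\<^esub> f A\<close>. Then, given finite
  approximations in sufficiently general position, a product of four conjugates of \<open>f\<close> can be made
  to agree with any prescribed automorphism on a larger finite set. A back-and-forth between
  two such products, \<open>P\<close> and \<open>Q\<close>, yields \<open>P = h Q\<close> for any given automorphism \<open>h\<close>, so that \<open>h\<close> is
  a product of four conjugates of \<open>f\<close> and four of \<open>f\<^sup>-\<^sup>1\<close>. Finally, for nontrivial \<open>g\<close>, no type of
  new points is fixed pointwise by \<open>g\<close>, and this suffices to build a commutator \<open>f\<close> of \<open>g\<close> that moves
  almost maximally; as \<open>f\<close> is the product of a conjugate of \<open>g\<^sup>-\<^sup>1\<close> and one of \<open>g\<close>, sixteen factors suffice.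
\<close>

section \<open>Closed permutation groups\<close>

text \<open>The obstacle is that a chain of four conjugates can be prolonged towards prescribed
  values only from a finite set \<open>Y\<close> on which it is in general position
  (\<open>good\<close>), and prolonging it does not restore general position on the larger set.
  Regaining it changes the outer conjugators and enlarges \<open>Y\<close>, and the values of the
  product at the new points cannot be prescribed. Hence no single product is steered to
  \<open>h\<close>. A second product is carried along, and whatever values arise in one of them are
  copied by the other, which is good at that moment. This back-and-forth stands in for a Baire
  category argument, and it is the reason for eight factors instead of four. Up to that point only
  the stationary independence relation is used. Freeness proper is needed for the commutator alone,
  where a base of independence has to be made smaller.\<close>

abbreviation iv :: "('a \<Rightarrow> 'a) \<Rightarrow> 'a \<Rightarrow> 'a" where "iv \<equiv> inv_into UNIV"

text \<open>\<open>closed\<close> is closedness under pointwise convergence, tested on finite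
  subsets of \<open>M\<close>. It is what puts the limits of the infinite constructions into
  \<open>G\<close>.\<close>

locale closed_perm_group =
  fixes M :: "'a set" and G :: "('a \<Rightarrow> 'a) set"
  assumes countable_M: "countable M"
    and permutes: "g \<in> G \<Longrightarrow> g permutes M"
    and id_in [simp, intro]: "id \<in> G"
    and comp_in [simp, intro]: "g \<in> G \<Longrightarrow> h \<in> G \<Longrightarrow> g \<circ> h \<in> G"
    and inv_in [simp, intro]: "g \<in> G \<Longrightarrow> iv g \<in> G"
    and closed: "c permutes M \<Longrightarrow>
      (\<And>S. finite S \<Longrightarrow> S \<subseteq> M \<Longrightarrow> \<exists>g\<in>G. \<forall>x\<in>S. g x = c x) \<Longrightarrow> c \<in> G"
begin

definition fsub :: "'a set \<Rightarrow> bool" where "fsub S \<longleftrightarrow> finite S \<and> S \<subseteq> M"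

definition stab :: "'a set \<Rightarrow> ('a \<Rightarrow> 'a) set" where "stab B = {u \<in> G. \<forall>x\<in>B. u x = x}"

text \<open>With the inverse on the left, \<open>cj k (u \<circ> v) = cj (cj k u) v\<close>. A
  conjugator is refined by composing it on the right with some \<open>v\<close>, and it keeps its
  values wherever \<open>v\<close> is the identity.\<close>

definition cj :: "('a \<Rightarrow> 'a) \<Rightarrow> ('a \<Rightarrow> 'a) \<Rightarrow> 'a \<Rightarrow> 'a" where "cj k u = iv u \<circ> k \<circ> u"

lemma bij_G: "g \<in> G \<Longrightarrow> bij g"
  using permutes permutes_bij by blast

lemma inv_G [simp]: "g \<in> G \<Longrightarrow> iv g (g x) = x" "g \<in> G \<Longrightarrow> g (iv g x) = x"
  using bij_G by (auto simp: bij_is_inj bij_is_surj surj_f_inv_f)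

lemma inv_image_G [simp]: "g \<in> G \<Longrightarrow> iv g ` g ` A = A" "g \<in> G \<Longrightarrow> g ` iv g ` A = A"
  by (simp_all add: image_image)

lemma eq_G [simp]: "g \<in> G \<Longrightarrow> g x = g y \<longleftrightarrow> x = y"
  using inv_G(1) by metis

lemma inv_inv_G [simp]: "g \<in> G \<Longrightarrow> iv (iv g) = g"
  by (simp add: bij_G inv_inv_eq)

lemma in_M_G [simp]: "g \<in> G \<Longrightarrow> g x \<in> M \<longleftrightarrow> x \<in> M"
  using permutes permutes_in_image by metis

lemma fsub_simps [simp]: "fsub {}" "fsub (A \<union> B) \<longleftrightarrow> fsub A \<and> fsub B"
  "fsub (insert x A) \<longleftrightarrow> x \<in> M \<and> fsub A"
  by (auto simp: fsub_def)

lemma fsub_image [simp]: "g \<in> G \<Longrightarrow> fsub (g ` A) \<longleftrightarrow> fsub A"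
  by (auto simp: fsub_def finite_image_iff inj_on_def)

lemma fsub_subset: "fsub A \<Longrightarrow> B \<subseteq> A \<Longrightarrow> fsub B"
  by (auto simp: fsub_def intro: finite_subset)

lemma stab_fix: "u \<in> stab B \<Longrightarrow> x \<in> B \<Longrightarrow> u x = x"
  by (simp add: stab_def)

lemma stabI: "u \<in> G \<Longrightarrow> (\<And>x. x \<in> B \<Longrightarrow> u x = x) \<Longrightarrow> u \<in> stab B"
  by (simp add: stab_def)

lemma stab_mono: "u \<in> stab B \<Longrightarrow> C \<subseteq> B \<Longrightarrow> u \<in> stab C"
  by (auto simp: stab_def)

lemma id_stab [simp]: "id \<in> stab B"
  by (simp add: stab_def)

lemma comp_stab: "u \<in> stab B \<Longrightarrow> v \<in> stab B \<Longrightarrow> u \<circ> v \<in> stab B"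
  by (simp add: stab_def)

lemma inv_stab: "u \<in> stab B \<Longrightarrow> iv u \<in> stab B"
proof (rule stabI)
  assume u: "u \<in> stab B"
  then have uG: "u \<in> G" unfolding stab_def by blast
  show "iv u \<in> G" using uG by (rule inv_in)
  fix x assume "x \<in> B"
  then have "u x = x" using u stab_fix by blast
  then show "iv u x = x" using inv_G(1)[OF uG, of x] by argo
qed

lemma stab_image: "u \<in> stab B \<Longrightarrow> A \<subseteq> B \<Longrightarrow> u ` A = A"
  using stab_fix by (metis image_cong image_ident subsetD)

lemma stab_G [simp]: "u \<in> stab B \<Longrightarrow> u \<in> G"
  by (auto simp: stab_def)

lemma cj_G [simp, intro]: "k \<in> G \<Longrightarrow> u \<in> G \<Longrightarrow> cj k u \<in> G"
  by (simp add: cj_def)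

lemma cj_apply: "cj k u x = iv u (k (u x))"
  by (simp add: cj_def)

lemma cj_comp: "u \<in> G \<Longrightarrow> v \<in> G \<Longrightarrow> cj k (u \<circ> v) = cj (cj k u) v"
  by (simp add: cj_def o_inv_distrib bij_G o_assoc)

lemma inv_comp_G: "u \<in> G \<Longrightarrow> v \<in> G \<Longrightarrow> iv (u \<circ> v) = iv v \<circ> iv u"
  by (simp add: o_inv_distrib bij_G)

lemma inv_cj: "k \<in> G \<Longrightarrow> u \<in> G \<Longrightarrow> iv (cj k u) = cj (iv k) u"
  by (simp add: cj_def inv_comp_G o_assoc)

lemma cj_stab: "u \<in> stab B \<Longrightarrow> x \<in> B \<Longrightarrow> k x \<in> B \<Longrightarrow> cj k u x = k x"
  using inv_stab[of u B] by (simp add: cj_apply stab_fix)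

text \<open>A pointwise limit of permutations is injective but may miss points. So
  \<open>ran\<close> is required beside \<open>dom\<close>: every point must be captured both as an
  argument and as a value.\<close>

lemma limit:
  fixes c :: "nat \<Rightarrow> 'a \<Rightarrow> 'a" and W :: "nat \<Rightarrow> 'a set"
  assumes c: "\<And>n. c n \<in> G" and W: "\<And>n. W n \<subseteq> W (Suc n)" "\<And>n. W n \<subseteq> M"
    and agree: "\<And>n x. x \<in> W n \<Longrightarrow> c (Suc n) x = c n x"
    and dom: "\<And>x. x \<in> M \<Longrightarrow> \<exists>n. x \<in> W n"
    and ran: "\<And>x. x \<in> M \<Longrightarrow> \<exists>n. x \<in> c n ` W n"
  shows "\<exists>d\<in>G. \<forall>n. \<forall>x\<in>W n. d x = c n x"
proof -
  have mono: "W m \<subseteq> W n" if "m \<le> n" for m n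
    using W(1) that by (rule lift_Suc_mono_le)
  have agr: "c n x = c m x" if "m \<le> n" "x \<in> W m" for m n x
    using that
  proof (induction n rule: dec_induct)
    case base show ?case by simp
  next
    case (step n)
    then show ?case using agree[of x n] mono[of m n] by auto
  qed
  define d where "d x = (if x \<in> M then c (LEAST n. x \<in> W n) x else x)" for x
  have d: "d x = c n x" if "x \<in> W n" for n x
  proof -
    have "x \<in> W (LEAST n. x \<in> W n)" "(LEAST n. x \<in> W n) \<le> n"
      using that by (auto intro: LeastI Least_le)
    then have "c n x = c (LEAST n. x \<in> W n) x" by (intro agr)
    then show ?thesis using W(2) that by (auto simp: d_def)
  qed
  have ub: "\<exists>n. S \<subseteq> W n" if "finite S" "S \<subseteq> M" for S
    using that
  proof (induction rule: finite_induct)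
    case empty show ?case by simp
  next
    case (insert x S)
    then obtain n m where "S \<subseteq> W n" "x \<in> W m" using dom[of x] by auto
    then have "insert x S \<subseteq> W (max n m)" using mono[of n "max n m"] mono[of m "max n m"] by auto
    then show ?case by blast
  qed
  have ap: "\<exists>g\<in>G. \<forall>x\<in>S. g x = d x" if "finite S" "S \<subseteq> M" for S
    using ub[OF that] c d by (metis subsetD)
  have "bij_betw d M M"
  proof (rule bij_betwI')
    fix x y assume "x \<in> M" "y \<in> M"
    then obtain g where "g \<in> G" "g x = d x" "g y = d y" using ap[of "{x,y}"] by auto
    then show "d x = d y \<longleftrightarrow> x = y" by (metis eq_G)
  next
    fix x assume "x \<in> M"
    then obtain g where "g \<in> G" "g x = d x" using ap[of "{x}"] by auto
    then show "d x \<in> M" using \<open>x \<in> M\<close> by (metis in_M_G)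
  next
    fix y assume "y \<in> M"
    then obtain n x where "x \<in> W n" "y = c n x" using ran by blast
    then show "\<exists>x\<in>M. y = d x" using d W(2) by (metis subsetD)
  qed
  then have "d permutes M" by (rule bij_imp_permutes) (simp add: d_def)
  then have "d \<in> G" using ap by (rule closed)
  with d show ?thesis by blast
qed

end

section \<open>Stationary independence\<close>

text \<open>The type of \<open>A\<close> over \<open>B\<close> is the orbit of \<open>A\<close>
  under \<open>stab B\<close>. The maps \<open>u\<close> that produce its members keep the
  enumeration that a tuple would have, so \<open>stationary\<close> concludes with an equality of
  maps on \<open>A\<close> and not merely of images.\<close>

locale stationary_independence = closed_perm_group M G for M :: "'a set" and G +
  fixes indep :: "'a set \<Rightarrow> 'a set \<Rightarrow> 'a set \<Rightarrow> bool"
  assumes indep_sym: "indep A B C \<Longrightarrow> indep C B A"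
    and indep_mono: "indep A B (C \<union> D) \<Longrightarrow> indep A B C"
    and indep_base: "indep A B (C \<union> D) \<Longrightarrow> indep A (B \<union> C) D"
    and indep_trans: "indep A B C \<Longrightarrow> indep A (B \<union> C) D \<Longrightarrow> indep A B (C \<union> D)"
    and indep_image: "g \<in> G \<Longrightarrow> indep A B C \<Longrightarrow> indep (g ` A) (g ` B) (g ` C)"
    and indep_ex: "fsub A \<Longrightarrow> fsub B \<Longrightarrow> fsub C \<Longrightarrow> \<exists>u\<in>stab B. indep (u ` A) B C"
    and stationary: "fsub A \<Longrightarrow> fsub B \<Longrightarrow> fsub C \<Longrightarrow> u \<in> stab B \<Longrightarrow> indep A B C \<Longrightarrow>
      indep (u ` A) B C \<Longrightarrow> \<exists>v\<in>stab (B \<union> C). \<forall>x\<in>A. v x = u x"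
begin

lemma indep_image_iff: "g \<in> G \<Longrightarrow> indep (g ` A) (g ` B) (g ` C) \<longleftrightarrow> indep A B C"
  using indep_image[of "iv g" "g ` A" "g ` B" "g ` C"] indep_image[of g A B C] by auto

lemma indep_stab: "u \<in> stab B \<Longrightarrow> indep (u ` A) B (u ` C) \<longleftrightarrow> indep A B C"
  using indep_image_iff[of u A B C] by (simp add: stab_image)

text \<open>Existence gives a copy of \<open>A\<close> independent from the base itself. The map
  producing the copy fixes that base, so invariance brings the independence back to
  \<open>A\<close>.\<close>

lemma indep_add_base:
  assumes "fsub A" "fsub B" "fsub C" "indep A B C"
  shows "indep A B (B \<union> C)"
proof -
  have "fsub (B \<union> C)" using assms by simp
  then obtain u where u: "u \<in> stab (B \<union> C)" "indep (u ` A) (B \<union> C) (B \<union> C)"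
    using indep_ex assms by blast
  then have "indep A (B \<union> C) (B \<union> C)"
    using indep_stab[OF u(1), of A "B \<union> C"] by (simp add: stab_image)
  with assms(4) have "indep A B (C \<union> (B \<union> C))" by (rule indep_trans)
  then show ?thesis by (simp add: Un_commute Un_left_commute)
qed

text \<open>The bookkeeping rule for most changes of sets: either side may absorb the base, and the
  base may grow into the right-hand side. It does not allow the base to shrink.\<close>

lemma indep_rebase:
  assumes "indep A B C" "fsub A" "fsub B" "fsub C"
    and "A' \<subseteq> A \<union> B" "B \<subseteq> B'" "B' \<subseteq> B \<union> C" "C' \<subseteq> B \<union> C"
  shows "indep A' B' C'"
proof -
  have "indep (B \<union> A) B C" using assms indep_add_base indep_sym by metis
  then have "indep (B \<union> A) B (B \<union> C)" using assms indep_add_base by simp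
  then have "indep (B \<union> C) B (A' \<union> (B \<union> A))"
    using assms(5) indep_sym by (metis Un_commute sup.absorb2)
  then have "indep A' B (B \<union> C)" using indep_mono indep_sym by metis
  then have "indep A' B (B' \<union> (B \<union> C))" using assms(7) by (simp add: sup.absorb2)
  then have "indep A' (B \<union> B') (B \<union> C)" by (rule indep_base)
  then have "indep A' B' (C' \<union> (B \<union> C))" using assms(6,8) by (simp add: sup.absorb2)
  then show ?thesis by (rule indep_mono)
qed

text \<open>Almost maximal movement in the sense of Tent and Ziegler.\<close>

definition am :: "('a \<Rightarrow> 'a) \<Rightarrow> bool" where
  "am g \<longleftrightarrow> g \<in> G \<and>
    (\<forall>A B. fsub A \<longrightarrow> fsub B \<longrightarrow> (\<exists>u\<in>stab B. indep (u ` A) B (g ` u ` A)))"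

lemma am_G [simp]: "am g \<Longrightarrow> g \<in> G"
  by (simp add: am_def)

lemma am_cj:
  assumes "am g" "c \<in> G"
  shows "am (cj g c)"
  unfolding am_def
proof (intro conjI allI impI)
  show "cj g c \<in> G" using assms by simp
  fix A B assume "fsub A" "fsub B"
  then have "fsub (c ` A)" "fsub (c ` B)" using assms by simp_all
  then obtain u where u: "u \<in> stab (c ` B)" "indep (u ` c ` A) (c ` B) (g ` u ` c ` A)"
    using assms am_def by meson
  have "indep (iv c ` u ` c ` A) (iv c ` c ` B) (iv c ` g ` u ` c ` A)"
    using u(2) assms by (intro indep_image) auto
  then have "indep ((iv c \<circ> u \<circ> c) ` A) B (cj g c ` (iv c \<circ> u \<circ> c) ` A)"
    using assms by (simp add: image_image cj_apply)
  moreover have "iv c \<circ> u \<circ> c \<in> stab B"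
    using u(1) assms by (intro stabI) (auto simp: stab_fix)
  ultimately show "\<exists>u\<in>stab B. indep (u ` A) B (cj g c ` u ` A)" by blast
qed

text \<open>Independence from \<open>C\<close> is arranged first. The movement is then applied over
  \<open>B \<union> C\<close>, by a map that fixes both sets and so spoils nothing.\<close>

lemma am_ex:
  assumes "am g" "fsub A" "fsub B" "fsub C"
  obtains u where "u \<in> stab B" "indep (u ` A) B C" "indep (u ` A) (B \<union> C) (g ` u ` A)"
proof -
  obtain v where v: "v \<in> stab B" "indep (v ` A) B C" using assms indep_ex by blast
  have "fsub (v ` A)" "fsub (B \<union> C)" using v(1) assms by simp_all
  then obtain w where w: "w \<in> stab (B \<union> C)" "indep (w ` v ` A) (B \<union> C) (g ` w ` v ` A)"
    using assms(1) am_def by meson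
  have "w \<circ> v \<in> stab B" by (rule comp_stab[OF stab_mono[OF w(1)] v(1)]) blast
  moreover have "indep (w ` v ` A) B C"
    using indep_image[of w "v ` A" B C] v(2) w(1) by (simp add: stab_image)
  ultimately show ?thesis using that[of "w \<circ> v"] w(2) by (simp add: image_comp)
qed

text \<open>If \<open>E\<close> is the preimage under \<open>g\<close> of the wanted copy, then
  \<open>g E\<close> and \<open>E\<close> have to be independent over \<open>D\<close>, whereas
  movement by \<open>g\<close> gives this over the preimage \<open>?Y\<close> of \<open>D\<close>.
  Choosing \<open>E\<close> independent from \<open>?C\<close> over \<open>?Y\<close> as well allows
  the bases to be exchanged.\<close>

lemma am_inv:
  assumes "am g"
  shows "am (iv g)"
  unfolding am_def
proof (intro conjI allI impI)
  have g: "g \<in> G" using assms by simp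
  then show "iv g \<in> G" by simp
  fix A D assume A: "fsub A" and D: "fsub D"
  let ?Y = "iv g ` D" and ?A = "iv g ` A"
  let ?C = "D \<union> iv g ` ?Y"
  have fin: "fsub ?Y" "fsub ?A" "fsub ?C" using A D g by simp_all
  then obtain u where u: "u \<in> stab ?Y" "indep (u ` ?A) ?Y ?C"
    "indep (u ` ?A) (?Y \<union> ?C) (g ` u ` ?A)"
    using am_ex[OF assms fin(2,1,3)] by metis
  let ?E = "u ` ?A"
  have E: "fsub ?E" "fsub (g ` ?E)" using u(1) A g by simp_all
  have "indep ?E ?Y (iv g ` ?Y)" using u(2) by (rule indep_rebase) (use E fin in auto)
  then have "indep (g ` ?E) (g ` ?Y) (g ` iv g ` ?Y)" using g by (rule indep_image[rotated])
  then have 1: "indep (g ` ?E) D ?Y" using g by simp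
  have "indep ?E ?Y (?C \<union> g ` ?E)" using u(2,3) by (rule indep_trans)
  then have "indep ?E (D \<union> ?Y) (g ` ?E)" by (rule indep_rebase) (use E fin in auto)
  then have "indep (g ` ?E) (D \<union> ?Y) ?E" by (rule indep_sym)
  with 1 have "indep (g ` ?E) D (?Y \<union> ?E)" by (rule indep_trans)
  then have 2: "indep (g ` ?E) D ?E" by (rule indep_rebase) (use E fin D in auto)
  let ?u = "g \<circ> u \<circ> iv g"
  have "?u ` A = g ` ?E" by (simp add: image_comp o_assoc)
  moreover have "iv g ` ?u ` A = ?E" using g by (simp add: image_image)
  moreover have "?u \<in> stab D" using u(1) g by (intro stabI) (auto simp: stab_fix)
  ultimately show "\<exists>u\<in>stab D. indep (u ` A) D (iv g ` u ` A)" using 2 by metis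
qed

text \<open>Movement speaks of some copy of \<open>A\<close>. Conjugating by the map that produces
  the copy turns this into a statement about \<open>A\<close> itself, with a conjugate of
  \<open>g\<close> in place of \<open>g\<close>.\<close>

lemma generic_move:
  assumes "am g" "fsub A" "fsub B" "fsub Z"
  obtains u where "u \<in> stab B" "indep (cj g u ` A) B (A \<union> Z)"
proof -
  have g: "g \<in> G" using assms(1) by simp
  obtain w where w: "w \<in> stab B" "indep (w ` A) B (g ` w ` A)"
    using assms am_def by meson
  have wG: "w \<in> G" using w(1) by simp
  have "indep (iv w ` w ` A) (iv w ` B) (iv w ` g ` w ` A)"
    using w wG by (intro indep_image) auto
  moreover have "iv w ` B = B" using inv_stab[OF w(1)] by (rule stab_image) simp
  moreover have "iv w ` g ` w ` A = cj g w ` A" by (simp add: image_image cj_apply)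
  ultimately have 1: "indep A B (cj g w ` A)" using wG by simp
  have f1: "fsub (cj g w ` A)" using fsub_image[OF cj_G[OF g wG]] assms(2) by blast
  have f2: "fsub (B \<union> A)" using assms(2,3) by simp
  obtain v where "v \<in> stab (B \<union> A) \<and> indep (v ` cj g w ` A) (B \<union> A) Z"
    using indep_ex[OF f1 f2 assms(4)] unfolding Bex_def by (rule exE)
  then have v: "v \<in> stab (B \<union> A)" "indep (v ` cj g w ` A) (B \<union> A) Z" by simp_all
  have vG: "v \<in> G" using v(1) by simp
  \<comment> \<open>\<open>iv v\<close> fixes \<open>A\<close>, so this second conjugation only
    moves the image of \<open>A\<close>, to a place independent from \<open>Z\<close> over
    \<open>B \<union> A\<close>.\<close>
  let ?u = "w \<circ> iv v"
  have "iv v ` A = A" using v(1) by (intro stab_image[OF inv_stab]) auto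
  then have eq: "cj g ?u ` A = v ` cj g w ` A"
    using wG vG by (metis cj_comp cj_def image_comp inv_in inv_inv_G)
  have "indep (cj g w ` A) B A" using 1 by (rule indep_sym)
  then have "indep (v ` cj g w ` A) (v ` B) (v ` A)" using vG by (rule indep_image[rotated])
  then have "indep (cj g ?u ` A) B A" using v(1) by (simp add: eq stab_image)
  then have "indep (cj g ?u ` A) B (A \<union> Z)" using v(2) eq by (metis indep_trans)
  moreover have "?u \<in> stab B" by (rule comp_stab[OF w(1) inv_stab[OF stab_mono[OF v(1)]]]) blast
  ultimately show ?thesis using that by blast
qed

text \<open>By stationarity, \<open>A \<union> p A\<close> looks over \<open>D \<union> g D\<close> like \<open>A' \<union> g A'\<close> for a generic copy \<open>A'\<close> of \<open>A\<close>.\<close>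

lemma realize:
  assumes "am g" "fsub D" "fsub A" "p \<in> G" "\<And>x. x \<in> D \<Longrightarrow> p x = g x"
    and AY: "indep A D (g ` D)" and pX: "indep (p ` A) (g ` D) D"
    and Ap: "indep A (D \<union> g ` D) (p ` A)"
  obtains u where "u \<in> stab (D \<union> g ` D)" "\<And>x. x \<in> A \<Longrightarrow> cj g u x = p x"
proof -
  let ?Y = "g ` D" and ?C = "iv g ` D"
  have g: "g \<in> G" using assms(1) by simp
  have fin: "fsub ?Y" "fsub ?C" "fsub (D \<union> ?Y)" "fsub (p ` A)" using assms g by simp_all
  \<comment> \<open>\<open>?C\<close> is included because \<open>g\<close> turns independence of the
    copy from \<open>?C\<close> over \<open>D\<close> into independence of its image from
    \<open>D\<close> over \<open>?Y\<close>.\<close>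
  obtain w where w: "w \<in> stab (D \<union> ?Y)" "indep (w ` A) (D \<union> ?Y) ?C"
    "indep (w ` A) (D \<union> ?Y \<union> ?C) (g ` w ` A)"
    using am_ex[OF assms(1,3) fin(3,2)] by metis
  have wG: "w \<in> G" using w(1) by simp
  have wA: "fsub (w ` A)" "fsub (g ` w ` A)" using wG g assms by simp_all
  have "indep (w ` A) (w ` D) (w ` ?Y)" using AY wG by (rule indep_image[rotated])
  then have "indep (w ` A) D ?Y" using w(1) by (simp add: stab_image)
  then have "indep (w ` A) D (?Y \<union> ?C)" using w(2) by (rule indep_trans)
  then have "indep (w ` A) D ?C" by (rule indep_rebase) (use wA fin assms in auto)
  then have "indep (g ` w ` A) (g ` D) (g ` ?C)" using g by (rule indep_image[rotated])
  then have gX: "indep (g ` w ` A) ?Y D" using g by simp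
  \<comment> \<open>\<open>?t\<close> carries \<open>p A\<close> to \<open>g w A\<close> and fixes
    \<open>?Y\<close>, because \<open>p\<close> and \<open>g\<close> agree on \<open>D\<close>. So
    these sets have one type over \<open>?Y\<close>, which stationarity improves to one type over
    \<open>?Y \<union> D\<close>.\<close>
  let ?t = "g \<circ> w \<circ> iv p"
  have "?t x = x" if "x \<in> ?Y" for x
  proof -
    obtain y where y: "y \<in> D" "x = g y" using \<open>x \<in> ?Y\<close> by blast
    then have "iv p x = y" using assms(4,5) by (metis inv_G(1))
    then show ?thesis using y w(1) by (simp add: stab_fix)
  qed
  then have t: "?t \<in> stab ?Y" using g wG assms(4) by (intro stabI) auto
  have "?t ` p ` A = g ` w ` A" using assms(4) by (simp add: image_image)
  then have "indep (?t ` p ` A) ?Y D" using gX by simp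
  then obtain v where v: "v \<in> stab (?Y \<union> D)" "\<forall>x\<in>p ` A. v x = ?t x"
    using stationary[OF fin(4,1) assms(2) t pX] by blast
  have vG: "v \<in> G" using v(1) by simp
  have vp: "v (p x) = g (w x)" if "x \<in> A" for x
    using v(2) that assms(4) by simp
  have v': "v \<in> stab (D \<union> ?Y)" using v(1) by (simp add: Un_commute)
  have "indep (w ` A) (D \<union> ?Y) (?C \<union> g ` w ` A)" using w(2,3) by (rule indep_trans)
  then have "indep (w ` A) (D \<union> ?Y) (g ` w ` A)"
    by (rule indep_rebase) (use wA fin assms in auto)
  moreover have "g ` w ` A = v ` p ` A" using vp by (simp add: image_image)
  moreover have "w ` A = v ` (iv v \<circ> w) ` A" using vG by (simp add: image_image)
  ultimately have "indep ((iv v \<circ> w) ` A) (D \<union> ?Y) (p ` A)"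
    using indep_stab[OF v'] by simp
  \<comment> \<open>Both \<open>A\<close> and the copy pulled back by \<open>v\<close> are
    independent from \<open>p A\<close> over \<open>D \<union> ?Y\<close>, so \<open>t\<close> can
    take one to the other while fixing \<open>p A\<close>. Then \<open>v \<circ> t\<close> matches
    \<open>A\<close> and \<open>p A\<close> simultaneously with \<open>w A\<close> and
    \<open>g w A\<close>.\<close>
  then obtain t where t: "t \<in> stab (D \<union> ?Y \<union> p ` A)" "\<forall>x\<in>A. t x = (iv v \<circ> w) x"
    using stationary[OF assms(3) fin(3,4) _ Ap] comp_stab[OF inv_stab[OF v'] w(1)] by blast
  have tG: "t \<in> G" using t(1) by simp
  have "v \<circ> t \<in> stab (D \<union> ?Y)" by (rule comp_stab[OF v' stab_mono[OF t(1)]]) blast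
  moreover have "cj g (v \<circ> t) x = p x" if "x \<in> A" for x
  proof -
    have "t (p x) = p x" using stab_fix[OF t(1)] that by blast
    moreover have "t x = iv v (w x)" using bspec[OF t(2) that] unfolding o_apply .
    ultimately have "(v \<circ> t) (p x) = g ((v \<circ> t) x)"
      unfolding o_apply using vp[OF that] inv_G(2)[OF vG, of "w x"] by argo
    then have "iv (v \<circ> t) (g ((v \<circ> t) x)) = iv (v \<circ> t) ((v \<circ> t) (p x))" by (rule arg_cong[OF sym])
    then show ?thesis using inv_G(1)[OF comp_in[OF vG tG], of "p x"] by (metis cj_apply)
  qed
  ultimately show ?thesis using that by blast
qed

lemma inv_eqI: "g \<in> G \<Longrightarrow> g x = y \<Longrightarrow> iv g y = x"
  using inv_G(1) by blast

text \<open>The outer two factors put \<open>A\<close> and \<open>p A\<close> into general position, and the inner two factors meet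
  in a generic set in the middle.\<close>

lemma four_step:
  assumes am: "am k0" "am k1" "am k2" "am k3" and Y0: "fsub Y0" and A: "fsub A" and p: "p \<in> G"
    and Y: "Y1 = k0 ` Y0" "Y2 = k1 ` Y1" "Y3 = k2 ` Y2" "Y4 = k3 ` Y3"
    and good: "indep Y0 Y1 Y2" "indep Y2 Y3 Y4"
    and p_eq: "\<And>x. x \<in> Y0 \<Longrightarrow> p x = k3 (k2 (k1 (k0 x)))"
  obtains u0 u1 u2 u3 where "u0 \<in> stab (Y0 \<union> Y1)" "u1 \<in> stab (Y1 \<union> Y2)" "u2 \<in> stab (Y2 \<union> Y3)"
    "u3 \<in> stab (Y3 \<union> Y4)"
    "\<And>x. x \<in> A \<Longrightarrow> cj k3 u3 (cj k2 u2 (cj k1 u1 (cj k0 u0 x))) = p x"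
proof -
  have k: "k0 \<in> G" "k1 \<in> G" "k2 \<in> G" "k3 \<in> G" using am am_G by blast+
  have Y1: "fsub Y1" unfolding Y(1) using fsub_image[OF k(1)] Y0 by blast
  have Y2: "fsub Y2" unfolding Y(2) using fsub_image[OF k(2)] Y1 by blast
  have Y3: "fsub Y3" unfolding Y(3) using fsub_image[OF k(3)] Y2 by blast
  have Y4: "fsub Y4" unfolding Y(4) using fsub_image[OF k(4)] Y3 by blast
  note fin = Y0 Y1 Y2 Y3 Y4
  have pA: "fsub (p ` A)" using A p fsub_image by blast
  have "fsub (Y0 \<union> Y1)" "fsub (Y3 \<union> Y4)" using fin by simp_all
  obtain u0 where u0: "u0 \<in> stab (Y0 \<union> Y1)" "indep (cj k0 u0 ` A) (Y0 \<union> Y1) (A \<union> Y2)"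
    using generic_move[OF am(1) A \<open>fsub (Y0 \<union> Y1)\<close> Y2] .
  \<comment> \<open>The last factor is run backwards: its inverse puts \<open>p A\<close> into
    general position, which yields \<open>A3\<close>.\<close>
  obtain u3 where u3: "u3 \<in> stab (Y3 \<union> Y4)"
    "indep (cj (iv k3) u3 ` p ` A) (Y3 \<union> Y4) (p ` A \<union> Y2)"
    using generic_move[OF am_inv[OF am(4)] pA \<open>fsub (Y3 \<union> Y4)\<close> Y2] .
  have uG: "u0 \<in> G" "u3 \<in> G" using u0(1) u3(1) stab_G by blast+
  define l0 where "l0 = cj k0 u0"
  define l3 where "l3 = cj k3 u3"
  have l: "l0 \<in> G" "l3 \<in> G" unfolding l0_def l3_def using k uG by blast+
  have l3': "cj (iv k3) u3 = iv l3" unfolding l3_def using inv_cj k uG by simp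
  define A1 where "A1 = l0 ` A"
  define A3 where "A3 = iv l3 ` p ` A"
  have A1: "fsub A1" unfolding A1_def using fsub_image[OF l(1)] A by blast
  have A3: "fsub A3" unfolding A3_def using fsub_image[OF inv_in[OF l(2)]] pA by blast
  have "indep A1 (Y0 \<union> Y1) (A \<union> Y2)" using u0(2) unfolding A1_def l0_def .
  then have "indep A1 (Y1 \<union> Y0) Y2" by (rule indep_rebase) (use A1 A fin in auto)
  \<comment> \<open>Goodness of the given chain lowers the base from \<open>Y0 \<union> Y1\<close>
    to \<open>Y1\<close>, as the second factor requires.\<close>
  then have "indep Y2 Y1 (Y0 \<union> A1)" using indep_trans indep_sym good(1) by meson
  then have "indep Y2 Y1 A1" by (rule indep_rebase) (use A1 fin in auto)
  then have ind1: "indep A1 Y1 Y2" by (rule indep_sym)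
  have "indep A3 (Y3 \<union> Y4) (p ` A \<union> Y2)" using u3(2) unfolding A3_def l3' .
  then have "indep A3 (Y3 \<union> Y4) Y2" by (rule indep_rebase) (use A3 pA fin in auto)
  then have "indep Y2 Y3 (Y4 \<union> A3)" using indep_trans indep_sym good(2) by meson
  then have "indep Y2 Y3 A3" by (rule indep_rebase) (use A3 fin in auto)
  then have ind3: "indep A3 Y3 Y2" by (rule indep_sym)
  \<comment> \<open>What the two inner factors have to achieve: \<open>q\<close> takes
    \<open>A1\<close> to \<open>A3\<close>.\<close>
  define q where "q = iv l3 \<circ> p \<circ> iv l0"
  have q: "q \<in> G" unfolding q_def using l p by blast
  have f: "fsub (k1 ` A1)" using fsub_image[OF k(2)] A1 by blast
  have f': "fsub (Y1 \<union> Y3 \<union> A1 \<union> A3)" using fin A1 A3 by simp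
  \<comment> \<open>The meeting point \<open>A2\<close> is a copy of \<open>k1 A1\<close> over
    \<open>Y2\<close>, independent from everything else in sight. It prescribes \<open>r\<close> for
    the second factor and \<open>q \<circ> iv r\<close> for the third.\<close>
  obtain v where v: "v \<in> stab Y2" "indep (v ` k1 ` A1) Y2 (Y1 \<union> Y3 \<union> A1 \<union> A3)"
    using indep_ex[OF f Y2 f'] unfolding Bex_def by blast
  define r where "r = v \<circ> k1"
  have r: "r \<in> G" unfolding r_def using v(1) stab_G k by blast
  define A2 where "A2 = r ` A1"
  have A2: "fsub A2" unfolding A2_def using fsub_image[OF r] A1 by blast
  have ind2: "indep A2 Y2 (Y1 \<union> Y3 \<union> A1 \<union> A3)" using v(2) unfolding A2_def r_def by (simp add: image_comp)
  have "indep A2 Y2 Y1" by (rule indep_rebase[OF ind2 A2 Y2 f']) auto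
  moreover have "indep A2 (Y1 \<union> Y2) A1" by (rule indep_rebase[OF ind2 A2 Y2 f']) auto
  then have "indep A1 (Y1 \<union> Y2) A2" by (rule indep_sym)
  moreover have "r x = k1 x" if "x \<in> Y1" for x
    unfolding r_def o_apply using stab_fix[OF v(1)] that Y(2) by blast
  ultimately obtain u1 where u1: "u1 \<in> stab (Y1 \<union> Y2)" "\<And>x. x \<in> A1 \<Longrightarrow> cj k1 u1 x = r x"
    using realize[OF am(2) Y1 A1 r] ind1 unfolding Y(2)[symmetric] A2_def by metis
  have qr: "(q \<circ> iv r) ` A2 = A3"
    unfolding A2_def A3_def A1_def q_def using r l by (simp add: image_image)
  have "(q \<circ> iv r) x = k2 x" if x: "x \<in> Y2" for x
  proof -
    obtain z where z: "z \<in> Y0" "x = k1 (k0 z)" using x Y by blast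
    have 1: "k0 z \<in> Y1" "k2 x \<in> Y3" "k3 (k2 x) \<in> Y4" using z x Y by blast+
    have "r (k0 z) = x" unfolding r_def o_apply using stab_fix[OF v(1) x] z by simp
    then have "iv r x = k0 z" by (rule inv_eqI[OF r])
    moreover have "l0 z = k0 z" unfolding l0_def by (rule cj_stab[OF u0(1)]) (use z 1 in auto)
    then have "iv l0 (k0 z) = z" by (rule inv_eqI[OF l(1)])
    moreover have "l3 (k2 x) = k3 (k2 x)" unfolding l3_def by (rule cj_stab[OF u3(1)]) (use 1 in auto)
    then have "iv l3 (k3 (k2 x)) = k2 x" by (rule inv_eqI[OF l(2)])
    ultimately show ?thesis unfolding q_def o_apply using p_eq[OF z(1)] z(2) by simp
  qed
  moreover have "indep A2 Y2 Y3" by (rule indep_rebase[OF ind2 A2 Y2 f']) auto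
  moreover have "indep A2 (Y2 \<union> Y3) A3" by (rule indep_rebase[OF ind2 A2 Y2 f']) auto
  moreover have "q \<circ> iv r \<in> G" using q r by blast
  ultimately obtain u2 where u2: "u2 \<in> stab (Y2 \<union> Y3)" "\<And>x. x \<in> A2 \<Longrightarrow> cj k2 u2 x = (q \<circ> iv r) x"
    using realize[OF am(3) Y2 A2, of "q \<circ> iv r"] ind3 unfolding Y(3)[symmetric] qr by metis
  show ?thesis
  proof (rule that[OF u0(1) u1(1) u2(1) u3(1)])
    fix x assume "x \<in> A"
    then have 1: "l0 x \<in> A1" "r (l0 x) \<in> A2" unfolding A1_def A2_def by blast+
    have "cj k2 u2 (cj k1 u1 (l0 x)) = q (l0 x)"
      using u1(2)[OF 1(1)] u2(2)[OF 1(2)] inv_G(1)[OF r] by simp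
    also have "\<dots> = iv l3 (p x)" unfolding q_def using inv_G(1)[OF l(1)] by simp
    finally show "cj k3 u3 (cj k2 u2 (cj k1 u1 (cj k0 u0 x))) = p x"
      unfolding l0_def[symmetric] l3_def[symmetric] using inv_G(2)[OF l(2)] by simp
  qed
qed

text \<open>\<open>T1\<close> is chosen to contain \<open>Y0 \<union> Y1\<close> and to make
  \<open>T3\<close> contain \<open>Y3 \<union> Y4\<close>. Changing the outer conjugators
  generically over these unions makes \<open>T0\<close> and \<open>T4\<close> independent from
  \<open>T2\<close>, and the bases can then be enlarged to \<open>T1\<close> and \<open>T3\<close>.
  The inner factors stay as they are.\<close>

lemma good_step:
  assumes am: "am k0" "am k1" "am k2" "am k3" and Y0: "fsub Y0"
    and Y: "Y1 = k0 ` Y0" "Y2 = k1 ` Y1" "Y3 = k2 ` Y2" "Y4 = k3 ` Y3"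
  obtains u0 u3 T0 T1 T2 T3 T4 where "u0 \<in> stab (Y0 \<union> Y1)" "u3 \<in> stab (Y3 \<union> Y4)"
    "fsub T0" "Y0 \<subseteq> T0" "T1 = cj k0 u0 ` T0" "T2 = k1 ` T1" "T3 = k2 ` T2" "T4 = cj k3 u3 ` T3"
    "indep T0 T1 T2" "indep T2 T3 T4"
proof -
  have k: "k0 \<in> G" "k1 \<in> G" "k2 \<in> G" "k3 \<in> G" using am am_G by blast+
  have Y1: "fsub Y1" unfolding Y(1) using fsub_image[OF k(1)] Y0 by blast
  have Y2: "fsub Y2" unfolding Y(2) using fsub_image[OF k(2)] Y1 by blast
  have Y3: "fsub Y3" unfolding Y(3) using fsub_image[OF k(3)] Y2 by blast
  have Y4: "fsub Y4" unfolding Y(4) using fsub_image[OF k(4)] Y3 by blast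
  note fin = Y0 Y1 Y2 Y3 Y4
  have fb: "fsub (Y0 \<union> Y1)" "fsub (Y3 \<union> Y4)" using fin by simp_all
  have k21: "k2 \<circ> k1 \<in> G" using k by blast
  define T1 where "T1 = Y0 \<union> Y1 \<union> Y2 \<union> iv (k2 \<circ> k1) ` (Y2 \<union> Y3 \<union> Y4)"
  define T2 where "T2 = k1 ` T1"
  define T3 where "T3 = k2 ` T2"
  have "fsub (Y2 \<union> Y3 \<union> Y4)" using fin by simp
  then have "fsub (iv (k2 \<circ> k1) ` (Y2 \<union> Y3 \<union> Y4))" using fsub_image[OF inv_in[OF k21]] by blast
  then have T1: "fsub T1" unfolding T1_def using fin by simp
  have T2: "fsub T2" unfolding T2_def using fsub_image[OF k(2)] T1 by blast
  have T3: "fsub T3" unfolding T3_def using fsub_image[OF k(3)] T2 by blast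
  have "(k2 \<circ> k1) ` iv (k2 \<circ> k1) ` (Y2 \<union> Y3 \<union> Y4) \<subseteq> T3"
    unfolding T3_def T2_def T1_def image_comp[symmetric] by blast
  then have T3_sup: "Y2 \<union> Y3 \<union> Y4 \<subseteq> T3" using inv_image_G(2)[OF k21] by simp
  obtain u0 where u0: "u0 \<in> stab (Y0 \<union> Y1)" "indep (cj (iv k0) u0 ` T1) (Y0 \<union> Y1) (T1 \<union> T2)"
    using generic_move[OF am_inv[OF am(1)] T1 fb(1) T2] .
  obtain u3 where u3: "u3 \<in> stab (Y3 \<union> Y4)" "indep (cj k3 u3 ` T3) (Y3 \<union> Y4) (T3 \<union> T2)"
    using generic_move[OF am(4) T3 fb(2) T2] .
  have uG: "u0 \<in> G" "u3 \<in> G" using u0(1) u3(1) stab_G by blast+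
  have l: "cj k0 u0 \<in> G" "cj k3 u3 \<in> G" using k uG by blast+
  define T0 where "T0 = iv (cj k0 u0) ` T1"
  define T4 where "T4 = cj k3 u3 ` T3"
  have T0: "fsub T0" unfolding T0_def using fsub_image[OF inv_in[OF l(1)]] T1 by blast
  have T4: "fsub T4" unfolding T4_def using fsub_image[OF l(2)] T3 by blast
  have "indep T0 (Y0 \<union> Y1) (T1 \<union> T2)" using u0(2) unfolding T0_def inv_cj[OF k(1) uG(1)] .
  then have 1: "indep T0 T1 T2" by (rule indep_rebase) (use T0 T1 T2 fin in \<open>auto simp: T1_def\<close>)
  have "indep T4 (Y3 \<union> Y4) (T3 \<union> T2)" using u3(2) unfolding T4_def .
  then have "indep T4 T3 T2" by (rule indep_rebase) (use T4 T3 T2 T3_sup fin in auto)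
  then have 2: "indep T2 T3 T4" by (rule indep_sym)
  have "Y0 \<subseteq> T0"
  proof
    fix x assume x: "x \<in> Y0"
    then have "k0 x \<in> Y1" using Y by blast
    moreover from this have "cj k0 u0 x = k0 x" using x by (intro cj_stab[OF u0(1)]) auto
    then have "iv (cj k0 u0) (k0 x) = x" by (rule inv_eqI[OF l(1)])
    ultimately show "x \<in> T0" unfolding T0_def T1_def by (metis UnCI image_eqI)
  qed
  moreover have "T1 = cj k0 u0 ` T0" unfolding T0_def using inv_image_G(2)[OF l(1)] by simp
  ultimately show ?thesis using that[OF u0(1) u3(1) T0] T2_def T3_def T4_def 1 2 by blast
qed

section \<open>Chains of four conjugates and their finite approximations\<close>

primrec pth :: "('a \<Rightarrow> 'a) \<Rightarrow> (nat \<Rightarrow> 'a \<Rightarrow> 'a) \<Rightarrow> nat \<Rightarrow> 'a \<Rightarrow> 'a" where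
  "pth g c 0 = id"
| "pth g c (Suc i) = cj g (c i) \<circ> pth g c i"

text \<open>The step \<open>cj g (c i)\<close> at \<open>x\<close> is determined by
  \<open>c i\<close> at \<open>x\<close> and at the next point of the path. Hence \<open>c i\<close>
  has to be settled on two consecutive images of \<open>Y\<close>.\<close>

definition window :: "('a \<Rightarrow> 'a) \<Rightarrow> (nat \<Rightarrow> 'a \<Rightarrow> 'a) \<Rightarrow> nat \<Rightarrow> 'a set \<Rightarrow> 'a set" where
  "window g c i Y = pth g c i ` Y \<union> pth g c (Suc i) ` Y"

definition agree ::
  "('a \<Rightarrow> 'a) \<Rightarrow> (nat \<Rightarrow> 'a \<Rightarrow> 'a) \<Rightarrow> (nat \<Rightarrow> 'a \<Rightarrow> 'a) \<Rightarrow> 'a set \<Rightarrow> bool" where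
  "agree g c c' Y \<longleftrightarrow> (\<forall>i<4. \<forall>x\<in>window g c i Y. c' i x = c i x)"

definition good :: "('a \<Rightarrow> 'a) \<Rightarrow> (nat \<Rightarrow> 'a \<Rightarrow> 'a) \<Rightarrow> 'a set \<Rightarrow> bool" where
  "good g c Y \<longleftrightarrow> indep Y (pth g c 1 ` Y) (pth g c 2 ` Y) \<and>
     indep (pth g c 2 ` Y) (pth g c 3 ` Y) (pth g c 4 ` Y)"

text \<open>What one round owes to the limit: each conjugator is settled on \<open>F\<close> and
  attains \<open>F\<close>, as \<open>dom\<close> and \<open>ran\<close> in \<open>limit\<close>
  demand.\<close>

definition covers :: "('a \<Rightarrow> 'a) \<Rightarrow> (nat \<Rightarrow> 'a \<Rightarrow> 'a) \<Rightarrow> 'a set \<Rightarrow> 'a set \<Rightarrow> bool" where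
  "covers g c Y F \<longleftrightarrow> F \<subseteq> Y \<and> (\<forall>i<4. F \<subseteq> window g c i Y \<and> F \<subseteq> c i ` window g c i Y)"

lemma pth_numeral:
  "pth g c 1 = cj g (c 0)"
  "pth g c 2 = cj g (c 1) \<circ> pth g c 1"
  "pth g c 3 = cj g (c 2) \<circ> pth g c 2"
  "pth g c 4 = cj g (c 3) \<circ> pth g c 3"
  by (simp_all add: eval_nat_numeral)

lemma pth_G: "g \<in> G \<Longrightarrow> \<forall>i. c i \<in> G \<Longrightarrow> pth g c i \<in> G"
  by (induction i) (simp_all add: id_def[symmetric])

lemma less_4: "(\<forall>i<4::nat. P i) \<longleftrightarrow> P 0 \<and> P 1 \<and> P 2 \<and> P 3"
  by (auto simp: eval_nat_numeral less_Suc_eq)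

lemma agree_pth:
  assumes "g \<in> G" "\<forall>i. c i \<in> G" "\<forall>i. c' i \<in> G" "agree g c c' Y" "x \<in> Y" "i \<le> 4"
  shows "pth g c' i x = pth g c i x"
  using assms(6)
proof (induction i)
  case 0 show ?case by simp
next
  case (Suc i)
  define y where "y = pth g c i x"
  have ci: "c i \<in> G" "c' i \<in> G" using assms by blast+
  have "y \<in> window g c i Y" "cj g (c i) y \<in> window g c i Y"
    using assms(5) by (auto simp: window_def y_def)
  then have "c' i y = c i y" "c' i (cj g (c i) y) = c i (cj g (c i) y)"
    using assms(4) Suc.prems unfolding agree_def by simp_all
  moreover have "c i (cj g (c i) y) = g (c i y)" unfolding cj_apply using inv_G(2)[OF ci(1)] .
  ultimately have "c' i (cj g (c i) y) = g (c' i y)" by simp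
  then have "cj g (c' i) y = cj g (c i) y" unfolding cj_apply[of g "c' i"] by (rule inv_eqI[OF ci(2)])
  then show ?case using Suc by (simp add: y_def)
qed

lemma agree_window:
  assumes "g \<in> G" "\<forall>i. c i \<in> G" "\<forall>i. c' i \<in> G" "agree g c c' Y" "Y \<subseteq> Y'" "i < 4"
  shows "window g c i Y \<subseteq> window g c' i Y'"
proof -
  have "pth g c j ` Y = pth g c' j ` Y" if "j \<le> 4" for j
    using agree_pth[OF assms(1-4) _ that] by (intro image_cong) simp_all
  from this[of i] this[of "Suc i"] assms(6)
  have "pth g c i ` Y = pth g c' i ` Y" "pth g c (Suc i) ` Y = pth g c' (Suc i) ` Y" by linarith+
  then show ?thesis unfolding window_def using assms(5) by blast
qed

lemma agree_trans:
  assumes "g \<in> G" "\<forall>i. c i \<in> G" "\<forall>i. c' i \<in> G" "agree g c c' Y" "agree g c' c'' Y'" "Y \<subseteq> Y'"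
  shows "agree g c c'' Y"
  using agree_window[OF assms(1-4,6)] assms(4,5) unfolding agree_def by (metis subsetD)

lemma covers_mono:
  assumes "g \<in> G" "\<forall>i. c i \<in> G" "\<forall>i. c' i \<in> G" "agree g c c' Y" "Y \<subseteq> Y'" "covers g c Y F"
  shows "covers g c' Y' F"
  unfolding covers_def
proof (intro conjI allI impI)
  show "F \<subseteq> Y'" using assms unfolding covers_def by blast
  fix i :: nat assume i: "i < 4"
  note w = agree_window[OF assms(1-5) i]
  then show "F \<subseteq> window g c' i Y'" using assms(6) i unfolding covers_def by blast
  have "c i ` window g c i Y = c' i ` window g c i Y"
    using assms(4) i unfolding agree_def by (intro image_cong) simp_all
  then show "F \<subseteq> c' i ` window g c' i Y'" using w assms(6) i unfolding covers_def by blast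
qed

text \<open>\<open>four_step\<close> for chains. Each correcting map fixes the window of its factor,
  so the new conjugators agree with the old ones there.\<close>

lemma chain_match:
  assumes g: "am g" and c: "\<forall>i. c i \<in> G" and Y: "fsub Y" "good g c Y" and A: "fsub A"
    and p: "p \<in> G" "\<forall>x\<in>Y. p x = pth g c 4 x"
  obtains c' where "\<forall>i. c' i \<in> G" "agree g c c' Y" "\<forall>x\<in>A. p x = pth g c' 4 x"
proof -
  define k where "k i = cj g (c i)" for i
  have k: "am (k i)" for i unfolding k_def using am_cj g c by blast
  have img: "pth g c 1 ` Y = k 0 ` Y" "pth g c 2 ` Y = k 1 ` pth g c 1 ` Y"
    "pth g c 3 ` Y = k 2 ` pth g c 2 ` Y" "pth g c 4 ` Y = k 3 ` pth g c 3 ` Y"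
    unfolding pth_numeral k_def image_comp by (rule refl)+
  have "p x = k 3 (k 2 (k 1 (k 0 x)))" if "x \<in> Y" for x
    using p(2) that by (simp add: pth_numeral k_def)
  with Y(2) obtain u0 u1 u2 u3 where
    u: "u0 \<in> stab (Y \<union> pth g c 1 ` Y)" "u1 \<in> stab (pth g c 1 ` Y \<union> pth g c 2 ` Y)"
    "u2 \<in> stab (pth g c 2 ` Y \<union> pth g c 3 ` Y)" "u3 \<in> stab (pth g c 3 ` Y \<union> pth g c 4 ` Y)" and
    eq: "\<And>x. x \<in> A \<Longrightarrow> cj (k 3) u3 (cj (k 2) u2 (cj (k 1) u1 (cj (k 0) u0 x))) = p x"
    using four_step[OF k k k k Y(1) A p(1) img] unfolding good_def by metis
  have uG: "u0 \<in> G" "u1 \<in> G" "u2 \<in> G" "u3 \<in> G" using u stab_G by blast+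
  define c' where "c' = c(0 := c 0 \<circ> u0, 1 := c 1 \<circ> u1, 2 := c 2 \<circ> u2, 3 := c 3 \<circ> u3)"
  have c': "c' 0 = c 0 \<circ> u0" "c' 1 = c 1 \<circ> u1" "c' 2 = c 2 \<circ> u2" "c' 3 = c 3 \<circ> u3"
    by (simp_all add: c'_def)
  have "\<forall>i. c' i \<in> G" using c uG by (simp add: c'_def)
  moreover have "agree g c c' Y"
    unfolding agree_def less_4 c' window_def
    using stab_fix[OF u(1)] stab_fix[OF u(2)] stab_fix[OF u(3)] stab_fix[OF u(4)]
    by (simp add: eval_nat_numeral)
  moreover have "cj (k 0) u0 = cj g (c' 0)" "cj (k 1) u1 = cj g (c' 1)" "cj (k 2) u2 = cj g (c' 2)"
    "cj (k 3) u3 = cj g (c' 3)"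
    unfolding c' k_def using cj_comp c uG by simp_all
  then have "\<forall>x\<in>A. p x = pth g c' 4 x" using eq by (simp add: pth_numeral)
  ultimately show ?thesis using that by blast
qed

lemma chain_good:
  assumes g: "am g" and c: "\<forall>i. c i \<in> G" and Y: "fsub Y" and F: "fsub F"
  obtains c' Y' where "\<forall>i. c' i \<in> G" "agree g c c' Y" "fsub Y'" "Y \<subseteq> Y'" "good g c' Y'"
    "covers g c' Y' F"
proof -
  have gG: "g \<in> G" using am_G[OF g] .
  note pG = pth_G[OF gG c]
  \<comment> \<open>Once \<open>E\<close> lies in every window, \<open>F\<close> lies both in the
    windows and in their images under the conjugators.\<close>
  define E where "E = F \<union> (\<Union>i\<in>{0..<4}. iv (c i) ` F)"
  have "fsub (iv (c i) ` F)" for i using fsub_image[OF inv_in] c F by blast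
  then have E: "fsub E" unfolding E_def using F by (simp add: fsub_def) blast
  \<comment> \<open>Pulling \<open>E\<close> back along the first and third paths suffices: each of
    the four windows contains the first or the third image of \<open>Z\<close>.\<close>
  define Z where "Z = Y \<union> F \<union> iv (pth g c 1) ` E \<union> iv (pth g c 3) ` E"
  have "fsub (iv (pth g c i) ` E)" for i using fsub_image[OF inv_in[OF pG]] E by blast
  then have Z: "fsub Z" unfolding Z_def fsub_simps(2) using Y F by blast
  have "E \<subseteq> pth g c i ` Z" if "i = 1 \<or> i = 3" for i
  proof -
    have "pth g c i ` iv (pth g c i) ` E \<subseteq> pth g c i ` Z" using that unfolding Z_def by blast
    then show ?thesis using inv_image_G(2)[OF pG] by simp
  qed
  note EZ' = this
  have EZ: "E \<subseteq> window g c i Z" if "i < 4" for i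
  proof -
    have "(i = 1 \<or> i = 3) \<or> (Suc i = 1 \<or> Suc i = 3)" using that by presburger
    then show ?thesis unfolding window_def using EZ' by blast
  qed
  have cov: "covers g c Z F"
    unfolding covers_def
  proof (intro conjI allI impI)
    show "F \<subseteq> Z" by (auto simp: Z_def)
    fix i :: nat assume i: "i < 4"
    show "F \<subseteq> window g c i Z" using EZ[OF i] by (auto simp: E_def)
    have "iv (c i) ` F \<subseteq> E" unfolding E_def using i by auto
    then have "c i ` iv (c i) ` F \<subseteq> c i ` window g c i Z"
      by (intro image_mono) (rule subset_trans[OF _ EZ[OF i]])
    then show "F \<subseteq> c i ` window g c i Z" using inv_image_G(2) c by simp
  qed
  define k where "k i = cj g (c i)" for i
  have k: "am (k i)" for i unfolding k_def using am_cj g c by blast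
  have img: "pth g c 1 ` Z = k 0 ` Z" "pth g c 2 ` Z = k 1 ` pth g c 1 ` Z"
    "pth g c 3 ` Z = k 2 ` pth g c 2 ` Z" "pth g c 4 ` Z = k 3 ` pth g c 3 ` Z"
    unfolding pth_numeral k_def image_comp by (rule refl)+
  obtain u0 u3 T0 T1 T2 T3 T4 where
    u: "u0 \<in> stab (Z \<union> pth g c 1 ` Z)" "u3 \<in> stab (pth g c 3 ` Z \<union> pth g c 4 ` Z)" and
    T: "fsub T0" "Z \<subseteq> T0" "T1 = cj (k 0) u0 ` T0" "T2 = k 1 ` T1" "T3 = k 2 ` T2"
      "T4 = cj (k 3) u3 ` T3" "indep T0 T1 T2" "indep T2 T3 T4"
    using good_step[OF k k k k Z img] .
  have uG: "u0 \<in> G" "u3 \<in> G" using u stab_G by blast+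
  define c' where "c' = c(0 := c 0 \<circ> u0, 3 := c 3 \<circ> u3)"
  have c': "c' 0 = c 0 \<circ> u0" "c' 1 = c 1" "c' 2 = c 2" "c' 3 = c 3 \<circ> u3"
    by (simp_all add: c'_def)
  have c'G: "\<forall>i. c' i \<in> G" using c uG by (simp add: c'_def)
  have agr: "agree g c c' Z"
    unfolding agree_def less_4 c' window_def
    using stab_fix[OF u(1)] stab_fix[OF u(2)] by (simp add: eval_nat_numeral)
  have cjk: "cj (k 0) u0 = cj g (c' 0)" "cj (k 3) u3 = cj g (c' 3)" "k 1 = cj g (c' 1)" "k 2 = cj g (c' 2)"
    unfolding c' k_def using cj_comp c uG by simp_all
  have T': "T1 = pth g c' 1 ` T0" "T2 = pth g c' 2 ` T0" "T3 = pth g c' 3 ` T0" "T4 = pth g c' 4 ` T0"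
    unfolding T(3-6) cjk pth_numeral image_comp by (simp_all add: o_assoc)
  show ?thesis
  proof (rule that[OF c'G _ T(1)])
    show "agree g c c' Y" using agr unfolding agree_def window_def Z_def by blast
    show "Y \<subseteq> T0" using T(2) by (auto simp: Z_def)
    show "good g c' T0" unfolding good_def using T(7,8) unfolding T' by blast
    show "covers g c' T0 F" by (rule covers_mono[OF gG c c'G agr T(2) cov])
  qed
qed

text \<open>The set \<open>Y\<close> grows in order to make \<open>d\<close> good; as \<open>c\<close> was good before, it can be adjusted so as to
  match \<open>d\<close> on the larger set. Afterwards the two chains exchange their roles.\<close>

lemma alternate:
  assumes g: "am g" and c: "\<forall>i. c i \<in> G" and d: "\<forall>i. d i \<in> G" and h: "h \<in> G"
    and Y: "fsub Y" "good g c Y" and F: "fsub F" and eq: "\<forall>x\<in>Y. pth g c 4 x = h (pth g d 4 x)"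
  obtains c' d' Y' where "\<forall>i. c' i \<in> G" "\<forall>i. d' i \<in> G" "agree g c c' Y" "agree g d d' Y"
    "Y \<subseteq> Y'" "fsub Y'" "good g d' Y'" "covers g d' Y' F"
    "\<forall>x\<in>Y'. pth g c' 4 x = h (pth g d' 4 x)"
proof -
  have gG: "g \<in> G" using am_G[OF g] .
  obtain d' Y' where d': "\<forall>i. d' i \<in> G" "agree g d d' Y" "fsub Y'" "Y \<subseteq> Y'" "good g d' Y'"
    "covers g d' Y' F"
    using chain_good[OF g d Y(1) F] .
  define p where "p = h \<circ> pth g d' 4"
  have p: "p \<in> G" unfolding p_def using h pth_G[OF gG d'(1)] by blast
  have "\<forall>x\<in>Y. p x = pth g c 4 x"
    unfolding p_def using eq agree_pth[OF gG d d'(1,2)] by simp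
  then obtain c' where c': "\<forall>i. c' i \<in> G" "agree g c c' Y" "\<forall>x\<in>Y'. p x = pth g c' 4 x"
    using chain_match[OF g c Y d'(3) p] by blast
  have "\<forall>x\<in>Y'. pth g c' 4 x = h (pth g d' 4 x)" using c'(3) by (simp add: p_def)
  then show ?thesis using that c'(1,2) d' by blast
qed

section \<open>Back-and-forth between two chains\<close>

definition state ::
  "('a \<Rightarrow> 'a) \<Rightarrow> ('a \<Rightarrow> 'a) \<Rightarrow> (nat \<Rightarrow> 'a \<Rightarrow> 'a) \<Rightarrow> (nat \<Rightarrow> 'a \<Rightarrow> 'a) \<Rightarrow> 'a set \<Rightarrow> bool" where
  "state g h c d Y \<longleftrightarrow> (\<forall>i. c i \<in> G) \<and> (\<forall>i. d i \<in> G) \<and> fsub Y \<and> good g c Y \<and>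
     (\<forall>x\<in>Y. pth g c 4 x = h (pth g d 4 x))"

text \<open>The invariant asks only \<open>c\<close> to be good. One use of \<open>alternate\<close>
  hands goodness to \<open>d\<close>, a second one with the inverse of \<open>h\<close> hands it
  back, and each use makes one of the chains cover \<open>F\<close>.\<close>

lemma state_extend:
  assumes g: "am g" and h: "h \<in> G" and s: "state g h c d Y" and F: "fsub F"
  obtains c' d' Y' where "state g h c' d' Y'" "agree g c c' Y" "agree g d d' Y" "Y \<subseteq> Y'"
    "covers g c' Y' F" "covers g d' Y' F"
proof -
  have gG: "g \<in> G" using am_G[OF g] .
  have c: "\<forall>i. c i \<in> G" and d: "\<forall>i. d i \<in> G" and Y: "fsub Y" "good g c Y"
    and eq: "\<forall>x\<in>Y. pth g c 4 x = h (pth g d 4 x)" using s unfolding state_def by blast+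
  obtain c1 d1 Y1 where 1: "\<forall>i. c1 i \<in> G" "\<forall>i. d1 i \<in> G" "agree g c c1 Y" "agree g d d1 Y"
    "Y \<subseteq> Y1" "fsub Y1" "good g d1 Y1" "covers g d1 Y1 F"
    "\<forall>x\<in>Y1. pth g c1 4 x = h (pth g d1 4 x)"
    using alternate[OF g c d h Y F eq] .
  have "\<forall>x\<in>Y1. pth g d1 4 x = iv h (pth g c1 4 x)" using 1(9) inv_G(1)[OF h] by simp
  then obtain d2 c2 Y2 where 2: "\<forall>i. d2 i \<in> G" "\<forall>i. c2 i \<in> G" "agree g d1 d2 Y1" "agree g c1 c2 Y1"
    "Y1 \<subseteq> Y2" "fsub Y2" "good g c2 Y2" "covers g c2 Y2 F"
    "\<forall>x\<in>Y2. pth g d2 4 x = iv h (pth g c2 4 x)"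
    using alternate[OF g 1(2,1) inv_in[OF h] 1(6,7) F] by blast
  have "\<forall>x\<in>Y2. pth g c2 4 x = h (pth g d2 4 x)" using 2(9) inv_G(2)[OF h] by simp
  then have "state g h c2 d2 Y2" unfolding state_def using 2 by blast
  then show ?thesis
  proof (rule that)
    show "agree g c c2 Y" by (rule agree_trans[OF gG c 1(1,3) 2(4) 1(5)])
    show "agree g d d2 Y" by (rule agree_trans[OF gG d 1(2,4) 2(3) 1(5)])
    show "Y \<subseteq> Y2" using 1(5) 2(5) by blast
    show "covers g c2 Y2 F" by (rule 2(8))
    show "covers g d2 Y2 F" by (rule covers_mono[OF gG 1(2) 2(1,3,5) 1(8)])
  qed
qed

lemma G_eqI:
  assumes "g \<in> G" "h \<in> G" "\<And>x. x \<in> M \<Longrightarrow> g x = h x"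
  shows "g = h"
proof
  fix x show "g x = h x"
    using assms(3) permutes[OF assms(1)] permutes[OF assms(2)]
    by (cases "x \<in> M") (auto simp: permutes_not_in)
qed

lemma agree_limit:
  assumes g: "g \<in> G" and c: "\<And>n i. c n i \<in> G" and Y: "\<And>n. Y n \<subseteq> Y (Suc n)" "\<And>n. fsub (Y n)"
    and agr: "\<And>n. agree g (c n) (c (Suc n)) (Y n)"
    and cov: "\<And>x. x \<in> M \<Longrightarrow> \<exists>n. covers g (c n) (Y n) {x}"
  obtains C where "\<forall>i. C i \<in> G" "\<And>n. agree g (c n) C (Y n)"
proof -
  have cn: "\<forall>i. c n i \<in> G" for n using c by blast
  have "\<exists>d\<in>G. \<forall>n. \<forall>x\<in>window g (c n) i (Y n). d x = c n i x" if i: "i < 4" for i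
  proof (rule limit)
    fix n show "c n i \<in> G" by (rule c)
    show "window g (c n) i (Y n) \<subseteq> window g (c (Suc n)) i (Y (Suc n))"
      by (rule agree_window[OF g cn cn agr Y(1) i])
    show "window g (c n) i (Y n) \<subseteq> M"
      using Y(2)[of n] in_M_G[OF pth_G[OF g cn]] unfolding window_def fsub_def by blast
    show "c (Suc n) i x = c n i x" if "x \<in> window g (c n) i (Y n)" for x
      using agr[of n] i that unfolding agree_def by blast
  next
    fix x assume "x \<in> M"
    from cov[OF this] obtain n where "covers g (c n) (Y n) {x}" ..
    with i show "\<exists>n. x \<in> window g (c n) i (Y n)" "\<exists>n. x \<in> c n i ` window g (c n) i (Y n)"
      unfolding covers_def by blast+
  qed
  then obtain D where D: "\<And>i. i < 4 \<Longrightarrow> D i \<in> G"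
    "\<And>i n x. i < 4 \<Longrightarrow> x \<in> window g (c n) i (Y n) \<Longrightarrow> D i x = c n i x" by metis
  \<comment> \<open>Only the indices below four matter; the identity is a filler in
    \<open>G\<close>.\<close>
  define C where "C i = (if i < 4 then D i else id)" for i
  have "\<forall>i. C i \<in> G" unfolding C_def using D(1) by simp
  moreover have "agree g (c n) C (Y n)" for n unfolding agree_def C_def using D(2) by simp
  ultimately show ?thesis using that by blast
qed

theorem am_product:
  assumes g: "am g" and h: "h \<in> G"
  obtains c d where "\<forall>i. c i \<in> G" "\<forall>i. d i \<in> G" "pth g c 4 = h \<circ> pth g d 4"
proof -
  have gG: "g \<in> G" using am_G[OF g] .
  \<comment> \<open>The intersection takes care of an empty \<open>M\<close>, for which
    \<open>from_nat_into\<close> is arbitrary.\<close>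
  define F where "F n = {from_nat_into M n} \<inter> M" for n
  have F: "fsub (F n)" for n unfolding F_def fsub_def by auto
  define st where "st = (\<lambda>(c, d, Y). state g h c d Y)"
  define ext where "ext = (\<lambda>n (c, d, Y) (c', d', Y'). agree g c c' Y \<and> agree g d d' Y \<and> Y \<subseteq> Y' \<and>
    covers g c' Y' (F n) \<and> covers g d' Y' (F n))"
  have "indep {} {} {}" using indep_ex[of "{}" "{}" "{}"] by simp
  then have "st (\<lambda>_. id, \<lambda>_. id, {})" unfolding st_def state_def good_def by simp
  moreover have "\<exists>t. st t \<and> ext n s t" if "st s" for s n
  proof -
    obtain c d Y where s: "s = (c, d, Y)" by (cases s)
    then have "state g h c d Y" using that unfolding st_def by simp
    then obtain c' d' Y' where "state g h c' d' Y'" "agree g c c' Y" "agree g d d' Y" "Y \<subseteq> Y'"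
      "covers g c' Y' (F n)" "covers g d' Y' (F n)"
      by (rule state_extend[OF g h _ F])
    then have "st (c', d', Y')" "ext n s (c', d', Y')" unfolding st_def ext_def s by simp_all
    then show ?thesis by blast
  qed
  ultimately obtain f where f: "\<And>n. st (f n)" "\<And>n. ext n (f n) (f (Suc n))"
    using dependent_nat_choice[of "\<lambda>_. st" ext] by metis
  define c d Y where "c n = fst (f n)" and "d n = fst (snd (f n))" and "Y n = snd (snd (f n))" for n
  have st: "state g h (c n) (d n) (Y n)" for n
    using f(1)[of n] by (simp add: st_def c_def d_def Y_def split_beta)
  have ext: "agree g (c n) (c (Suc n)) (Y n)" "agree g (d n) (d (Suc n)) (Y n)" "Y n \<subseteq> Y (Suc n)"
    "covers g (c (Suc n)) (Y (Suc n)) (F n)" "covers g (d (Suc n)) (Y (Suc n)) (F n)" for n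
    using f(2)[of n] by (simp_all add: ext_def c_def d_def Y_def split_beta)
  have cG: "c n i \<in> G" and dG: "d n i \<in> G" and Y: "fsub (Y n)"
    and eq: "x \<in> Y n \<Longrightarrow> pth g (c n) 4 x = h (pth g (d n) 4 x)" for n i x
    using st[of n] unfolding state_def by blast+
  have Fx: "\<exists>n. F n = {x}" if "x \<in> M" for x
    using from_nat_into_surj[OF countable_M that] that unfolding F_def by auto
  have covc: "\<exists>n. covers g (c n) (Y n) {x}" and covd: "\<exists>n. covers g (d n) (Y n) {x}" if "x \<in> M" for x
    using Fx[OF that] ext(4,5) by metis+
  obtain C where C: "\<forall>i. C i \<in> G" "\<And>n. agree g (c n) C (Y n)"
    using agree_limit[of g c Y, OF gG cG ext(3) Y ext(1) covc] by blast
  obtain D where D: "\<forall>i. D i \<in> G" "\<And>n. agree g (d n) D (Y n)"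
    using agree_limit[of g d Y, OF gG dG ext(3) Y ext(2) covd] by blast
  have cn: "\<forall>i. c n i \<in> G" "\<forall>i. d n i \<in> G" for n using cG dG by blast+
  have "pth g C 4 = h \<circ> pth g D 4"
  proof (rule G_eqI)
    show "pth g C 4 \<in> G" "h \<circ> pth g D 4 \<in> G" using pth_G[OF gG] C(1) D(1) h by blast+
    fix x assume "x \<in> M"
    then obtain n where x: "x \<in> Y n" using covc unfolding covers_def by blast
    show "pth g C 4 x = (h \<circ> pth g D 4) x"
      using agree_pth[OF gG cn(1) C(1,2) x, of 4] agree_pth[OF gG cn(2) D(1,2) x, of 4] eq[OF x]
      by simp
  qed
  then show ?thesis using that C(1) D(1) by blast
qed

end

section \<open>Free independence in homogeneous relational structures\<close>

text \<open>Automorphisms as permutations of the whole type that are the identity off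
  \<open>M\<close>, so that composition and inversion are the plain operations.\<close>

definition autg :: "'a set \<Rightarrow> ('r \<Rightarrow> 'a list \<Rightarrow> bool) \<Rightarrow> ('a \<Rightarrow> 'a) set" where
  "autg M rl = {p. p permutes M \<and> (\<forall>R xs. rl R (map p xs) = rl R xs)}"

definition free_indep :: "('r \<Rightarrow> 'a list \<Rightarrow> bool) \<Rightarrow> 'a set \<Rightarrow> 'a set \<Rightarrow> 'a set \<Rightarrow> bool" where
  "free_indep rl A B C \<longleftrightarrow> A \<inter> C \<subseteq> B \<and>
     (\<forall>R xs. rl R xs \<longrightarrow> set xs \<subseteq> A \<union> B \<union> C \<longrightarrow> set xs \<subseteq> A \<union> B \<or> set xs \<subseteq> B \<union> C)"

lemma free_indepD:
  "free_indep rl A B C \<Longrightarrow> rl R xs \<Longrightarrow> set xs \<subseteq> A \<union> B \<union> C \<Longrightarrow> set xs \<subseteq> A \<union> B \<or> set xs \<subseteq> B \<union> C"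
  "free_indep rl A B C \<Longrightarrow> A \<inter> C \<subseteq> B"
  by (auto simp: free_indep_def)

lemma free_indepI:
  assumes "A \<inter> C \<subseteq> B"
    and "\<And>R xs. rl R xs \<Longrightarrow> set xs \<subseteq> A \<union> B \<union> C \<Longrightarrow> \<not> set xs \<subseteq> A \<union> B \<Longrightarrow> set xs \<subseteq> B \<union> C"
  shows "free_indep rl A B C"
  using assms unfolding free_indep_def by blast

text \<open>All that the argument takes from the limit besides transitivity and nondegeneracy:
  \<open>free_extension\<close> combines free amalgamation with the embedding of the amalgam, and
  the class itself disappears.\<close>

locale free_homogeneous =
  fixes M :: "'a set" and rl :: "'r \<Rightarrow> 'a list \<Rightarrow> bool"
  assumes countable_carrier: "countable M"
    and rl_M: "rl R xs \<Longrightarrow> set xs \<subseteq> M"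
    and homogeneous: "finite S \<Longrightarrow> S \<subseteq> M \<Longrightarrow> inj_on f S \<Longrightarrow> f ` S \<subseteq> M \<Longrightarrow>
      (\<And>R xs. set xs \<subseteq> S \<Longrightarrow> rl R (map f xs) = rl R xs) \<Longrightarrow> \<exists>g\<in>autg M rl. \<forall>x\<in>S. g x = f x"
    and free_extension: "finite A \<Longrightarrow> A \<subseteq> M \<Longrightarrow> finite B \<Longrightarrow> B \<subseteq> M \<Longrightarrow> finite C \<Longrightarrow> C \<subseteq> M \<Longrightarrow>
      \<exists>u\<in>autg M rl. (\<forall>x\<in>B. u x = x) \<and> free_indep rl (u ` A) B C"
begin

abbreviation "G \<equiv> autg M rl"

lemma rl_aut: "g \<in> G \<Longrightarrow> rl R (map g xs) = rl R xs"
  by (simp add: autg_def)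

lemma closed_perm_group_autg: "closed_perm_group M G"
proof
  show "countable M" by (rule countable_carrier)
  show "g permutes M" if "g \<in> G" for g using that by (simp add: autg_def)
  show "id \<in> G" by (simp add: autg_def permutes_id)
  show "g \<circ> h \<in> G" if "g \<in> G" "h \<in> G" for g h
    using that by (auto simp: autg_def permutes_compose simp flip: map_map)
  show "iv g \<in> G" if "g \<in> G" for g
  proof -
    have g: "g permutes M" using that by (simp add: autg_def)
    have "rl R (map (iv g) xs) = rl R xs" for R xs
      using rl_aut[OF that, of R "map (iv g) xs"] permutes_inv_o(1)[OF g] by simp
    then show ?thesis using permutes_inv[OF g] by (simp add: autg_def)
  qed
  show "c \<in> G" if c: "c permutes M" and
    approx: "\<And>S. finite S \<Longrightarrow> S \<subseteq> M \<Longrightarrow> \<exists>g\<in>G. \<forall>x\<in>S. g x = c x" for c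
  proof -
    have "rl R (map c xs) = rl R xs" for R xs
    proof (cases "set xs \<subseteq> M")
      case True
      then obtain g where g: "g \<in> G" "\<forall>x\<in>set xs. g x = c x" using approx[of "set xs"] by auto
      then have "map c xs = map g xs" by simp
      then show ?thesis using rl_aut[OF g(1)] by metis
    next
      case False
      then have "\<not> set (map c xs) \<subseteq> M" using permutes_in_image[OF c] by auto
      then show ?thesis using False rl_M by blast
    qed
    then show ?thesis using c by (simp add: autg_def)
  qed
qed

sublocale closed_perm_group M G
  by (rule closed_perm_group_autg)

text \<open>The map that is \<open>u\<close> on \<open>A\<close> and the identity on
  \<open>C\<close> is a partial isomorphism, since before and after it relations live on one side
  only; homogeneity extends it. By \<open>f1\<close> and \<open>f2\<close>, a tuple contained in
  neither side is mapped to one contained in neither side.\<close>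

lemma free_stationary:
  assumes fin: "fsub A" "fsub B" "fsub C" and u: "u \<in> stab B"
    and ind: "free_indep rl A B C" "free_indep rl (u ` A) B C"
  shows "\<exists>v\<in>stab (B \<union> C). \<forall>x\<in>A. v x = u x"
proof -
  have uG: "u \<in> G" using u by simp
  have uB: "u x = x" if "x \<in> B" for x using stab_fix[OF u that] .
  define f where "f x = (if x \<in> A then u x else x)" for x
  have fA: "f x = u x" if "x \<in> A \<union> B" for x using that uB by (auto simp: f_def)
  have fC: "f x = x" if "x \<in> B \<union> C" for x
    using that uB free_indepD(2)[OF ind(1)] by (auto simp: f_def)
  have f1: "x \<in> A \<union> B" if "x \<in> A \<union> B \<union> C" "f x \<in> u ` A \<union> B" for x
    using that fC[of x] free_indepD(2)[OF ind(2)] by auto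
  have f2: "x \<in> B \<union> C" if x: "x \<in> A \<union> B \<union> C" "f x \<in> B \<union> C" for x
  proof (cases "x \<in> A")
    case True
    then have "u x \<in> B" using x(2) fA[of x] free_indepD(2)[OF ind(2)] by auto
    then have "u (u x) = u x" by (rule uB)
    then have "u x = x" using eq_G[OF uG] by blast
    then show ?thesis using \<open>u x \<in> B\<close> by simp
  next
    case False
    then show ?thesis using x by auto
  qed
  have finS: "fsub (A \<union> B \<union> C)" using fin by simp
  have "inj_on f (A \<union> B \<union> C)"
  proof (rule inj_onI)
    fix x y assume xy: "x \<in> A \<union> B \<union> C" "y \<in> A \<union> B \<union> C" "f x = f y"
    show "x = y"
    proof (cases "x \<in> B \<union> C")
      case True
      then have "y \<in> B \<union> C" using f2[OF xy(2)] fC[OF True] xy(3) by simp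
      then show ?thesis using True fC xy(3) by metis
    next
      case False
      then have x: "x \<in> A \<union> B" using xy(1) by blast
      then have "f x \<in> u ` A \<union> B" using fA uB by auto
      then have "y \<in> A \<union> B" using f1[OF xy(2)] xy(3) by simp
      then show ?thesis using x fA xy(3) eq_G[OF uG] by metis
    qed
  qed
  moreover have "f ` (A \<union> B \<union> C) \<subseteq> M"
    using finS in_M_G[OF uG] by (auto simp: fsub_def f_def)
  moreover have "rl R (map f xs) = rl R xs" if xs: "set xs \<subseteq> A \<union> B \<union> C" for R xs
  proof (cases "set xs \<subseteq> A \<union> B \<or> set xs \<subseteq> B \<union> C")
    case True
    then show ?thesis
    proof
      assume "set xs \<subseteq> A \<union> B"
      then have "map f xs = map u xs" using fA by auto
      then show ?thesis using rl_aut[OF uG] by metis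
    next
      assume "set xs \<subseteq> B \<union> C"
      then have "map f xs = xs" using fC by (intro map_idI) blast
      then show ?thesis by (rule arg_cong)
    qed
  next
    case False
    have "f x \<in> u ` A \<union> B \<union> C" if "x \<in> A \<union> B \<union> C" for x using that by (auto simp: f_def)
    then have "set (map f xs) \<subseteq> u ` A \<union> B \<union> C" using xs by auto
    moreover have "\<not> set (map f xs) \<subseteq> u ` A \<union> B" "\<not> set (map f xs) \<subseteq> B \<union> C"
      using False f1 f2 xs unfolding set_map image_subset_iff by blast+
    ultimately have "\<not> rl R (map f xs)" using free_indepD(1)[OF ind(2)] by blast
    then show ?thesis using free_indepD(1)[OF ind(1) _ xs] False by blast
  qed
  ultimately obtain v where v: "v \<in> G" "\<forall>x\<in>A \<union> B \<union> C. v x = f x"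
    using homogeneous[of "A \<union> B \<union> C" f] finS unfolding fsub_def by blast
  have "v \<in> stab (B \<union> C)" using v fC by (intro stabI) auto
  moreover have "\<forall>x\<in>A. v x = u x" using v(2) fA by auto
  ultimately show ?thesis by blast
qed

sublocale stationary_independence M G "free_indep rl"
proof
  fix A B C D
  show "free_indep rl C B A" if "free_indep rl A B C"
  proof (rule free_indepI)
    show "C \<inter> A \<subseteq> B" using free_indepD(2)[OF that] by blast
    fix R xs assume "rl R xs" "set xs \<subseteq> C \<union> B \<union> A" "\<not> set xs \<subseteq> C \<union> B"
    then show "set xs \<subseteq> B \<union> A" using free_indepD(1)[OF that, of R xs] by blast
  qed
  show "free_indep rl A B C" if "free_indep rl A B (C \<union> D)"
  proof (rule free_indepI)
    note 1 = free_indepD(2)[OF that]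
    then show "A \<inter> C \<subseteq> B" by blast
    fix R xs assume "rl R xs" "set xs \<subseteq> A \<union> B \<union> C" "\<not> set xs \<subseteq> A \<union> B"
    then have "set xs \<subseteq> B \<union> (C \<union> D)" using free_indepD(1)[OF that, of R xs] by blast
    then show "set xs \<subseteq> B \<union> C" using 1 \<open>set xs \<subseteq> A \<union> B \<union> C\<close> by blast
  qed
  show "free_indep rl A (B \<union> C) D" if "free_indep rl A B (C \<union> D)"
  proof (rule free_indepI)
    show "A \<inter> D \<subseteq> B \<union> C" using free_indepD(2)[OF that] by blast
    fix R xs assume "rl R xs" "set xs \<subseteq> A \<union> (B \<union> C) \<union> D" "\<not> set xs \<subseteq> A \<union> (B \<union> C)"
    then show "set xs \<subseteq> B \<union> C \<union> D" using free_indepD(1)[OF that, of R xs] by blast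
  qed
  show "free_indep rl A B (C \<union> D)" if "free_indep rl A B C" "free_indep rl A (B \<union> C) D"
  proof (rule free_indepI)
    show "A \<inter> (C \<union> D) \<subseteq> B" using free_indepD(2)[OF that(1)] free_indepD(2)[OF that(2)] by blast
    fix R xs assume xs: "rl R xs" "set xs \<subseteq> A \<union> B \<union> (C \<union> D)" "\<not> set xs \<subseteq> A \<union> B"
    show "set xs \<subseteq> B \<union> (C \<union> D)"
    proof (cases "set xs \<subseteq> A \<union> B \<union> C")
      case True
      then show ?thesis using free_indepD(1)[OF that(1) xs(1)] xs(3) by blast
    next
      case False
      then show ?thesis using free_indepD(1)[OF that(2) xs(1)] xs(2) by blast
    qed
  qed
  show "free_indep rl (g ` A) (g ` B) (g ` C)" if "g \<in> G" "free_indep rl A B C" for g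
  proof (rule free_indepI)
    have "x \<in> g ` S \<longleftrightarrow> iv g x \<in> S" for x S
      using inv_G[OF that(1)] by (metis imageE imageI)
    then have im: "set xs \<subseteq> g ` S \<longleftrightarrow> set (map (iv g) xs) \<subseteq> S" for xs S
      unfolding set_map image_subset_iff subset_iff by blast
    have "g ` A \<inter> g ` C = g ` (A \<inter> C)" by (rule image_Int[symmetric]) (simp add: inj_on_def that(1))
    then show "g ` A \<inter> g ` C \<subseteq> g ` B" using free_indepD(2)[OF that(2)] by (simp add: image_mono)
    fix R xs assume xs: "rl R xs" "set xs \<subseteq> g ` A \<union> g ` B \<union> g ` C" "\<not> set xs \<subseteq> g ` A \<union> g ` B"
    have "rl R (map (iv g) xs)" using rl_aut[OF inv_in[OF that(1)]] xs(1) by simp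
    then show "set xs \<subseteq> g ` B \<union> g ` C"
      using free_indepD(1)[OF that(2)] xs(2,3) im unfolding image_Un[symmetric] by metis
  qed
  show "\<exists>u\<in>stab B. free_indep rl (u ` A) B C" if "fsub A" "fsub B" "fsub C"
    using free_extension[of A B C] that unfolding fsub_def stab_def by blast
  show "\<exists>v\<in>stab (B \<union> C). \<forall>x\<in>A. v x = u x"
    if "fsub A" "fsub B" "fsub C" "u \<in> stab B" "free_indep rl A B C" "free_indep rl (u ` A) B C" for u
    using free_stationary that by blast
qed

text \<open>This is where freeness goes beyond stationarity: the base may be shrunk, not only enlarged.\<close>

lemma free_indep_shrink:
  assumes "free_indep rl A B C" "D \<subseteq> B" "(A \<union> C) \<inter> B \<subseteq> D"
  shows "free_indep rl A D C"
proof (rule free_indepI)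
  show "A \<inter> C \<subseteq> D" using free_indepD(2)[OF assms(1)] assms(3) by blast
  fix R xs assume xs: "rl R xs" "set xs \<subseteq> A \<union> D \<union> C" "\<not> set xs \<subseteq> A \<union> D"
  then have "set xs \<subseteq> A \<union> B \<or> set xs \<subseteq> B \<union> C" using free_indepD(1)[OF assms(1) xs(1)] assms(2) by blast
  then show "set xs \<subseteq> D \<union> C"
  proof
    assume 1: "set xs \<subseteq> A \<union> B"
    have "x \<in> A \<union> D" if x: "x \<in> set xs" for x
      using x 1 xs(2) assms(3) free_indepD(2)[OF assms(1)] by blast
    then show ?thesis using xs(3) by blast
  next
    assume 1: "set xs \<subseteq> B \<union> C"
    show ?thesis using 1 xs(2) assms(3) by blast
  qed
qed

text \<open>Under transitivity a tuple on a single point cannot distinguish points. The bound also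
  admits the empty tuple of a nullary relation.\<close>

lemma rl_degenerate:
  assumes transitive: "\<And>x y. x \<in> M \<Longrightarrow> y \<in> M \<Longrightarrow> \<exists>g\<in>G. g x = y"
    and "set xs \<subseteq> M" "f ` set xs \<subseteq> M" "card (set xs) \<le> 1"
  shows "rl R (map f xs) = rl R xs"
proof (cases "xs = []")
  case True
  then show ?thesis by simp
next
  case False
  then have "set xs \<noteq> {}" by simp
  then have "card (set xs) = 1" using assms(4) by (simp add: le_Suc_eq)
  then obtain x where x: "set xs = {x}" by (auto simp: card_1_singleton_iff)
  then have "x \<in> M" "f x \<in> M" using assms(2,3) by auto
  then obtain p where p: "p \<in> G" "p x = f x" using transitive by blast
  have "map f xs = map p xs" using x p(2) by simp
  then show ?thesis using rl_aut[OF p(1)] by metis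
qed

end

section \<open>A commutator that moves almost maximally\<close>

text \<open>\<open>nondegenerate\<close> is the form in which failure of indiscernibility is used:
  some relation links at least two points.\<close>

locale transitive_free_homogeneous = free_homogeneous M rl
  for M :: "'a set" and rl :: "'r \<Rightarrow> 'a list \<Rightarrow> bool" +
  assumes transitive: "x \<in> M \<Longrightarrow> y \<in> M \<Longrightarrow> \<exists>g\<in>G. g x = y"
    and nondegenerate: "\<exists>R xs. rl R xs \<and> 2 \<le> card (set xs)"
begin

lemma free_indep_mono:
  assumes "free_indep rl A B C" "A' \<subseteq> A" "C' \<subseteq> C"
  shows "free_indep rl A' B C'"
proof -
  have "free_indep rl A B C'" using assms(1,3) indep_mono by (metis sup.absorb2)
  then have "free_indep rl C' B A'" using assms(2) indep_mono indep_sym by (metis sup.absorb2)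
  then show ?thesis by (rule indep_sym)
qed

text \<open>A related set \<open>T\<close> through \<open>b\<close> is placed freely over
  \<open>b\<close> from \<open>D\<close> and \<open>g b\<close>. If \<open>g\<close> fixes
  \<open>T\<close> except for \<open>b\<close>, then exchanging \<open>b\<close> for
  \<open>g b\<close> in \<open>T\<close> gives a related set again, and it crosses the free
  amalgam.\<close>

lemma fix_if_fixes_free:
  assumes g: "g \<in> G" and b: "b \<in> M" and D: "fsub D"
    and fixes_free: "\<And>s. s \<in> M \<Longrightarrow> s \<notin> D \<Longrightarrow> s \<noteq> b \<Longrightarrow> free_indep rl {s} {b} D \<Longrightarrow> g s = s"
  shows "g b = b"
proof (rule ccontr)
  assume ne: "g b \<noteq> b"
  obtain R xs where xs: "rl R xs" "2 \<le> card (set xs)" using nondegenerate by blast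
  then have "set xs \<noteq> {}" by auto
  then obtain a where a: "a \<in> set xs" by (metis all_not_in_conv)
  then obtain t where t: "t \<in> G" "t a = b" using transitive b rl_M[OF xs(1)] by blast
  have "fsub (set xs)" using rl_M[OF xs(1)] by (simp add: fsub_def)
  then have "fsub (t ` set xs)" using fsub_image[OF t(1)] by blast
  moreover have "fsub {b}" using b by simp
  moreover have "fsub (insert (g b) D)" using in_M_G[OF g] b D by simp
  ultimately obtain u where u: "u \<in> stab {b}" "free_indep rl (u ` t ` set xs) {b} (insert (g b) D)"
    using indep_ex by blast
  have uG: "u \<in> G" using stab_G[OF u(1)] .
  define T where "T = u ` t ` set xs"
  have ut: "u \<circ> t \<in> G" using uG t by blast
  have T_M: "T \<subseteq> M"
    using rl_M[OF xs(1)] in_M_G[OF ut] unfolding T_def by (auto simp: image_comp)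
  have ub: "u b = b" using stab_fix[OF u(1)] by blast
  have bT: "b \<in> T" unfolding T_def using a t(2) ub by force
  have ind: "free_indep rl T {b} (insert (g b) D)" using u(2) unfolding T_def .
  have gbT: "g b \<notin> T" using free_indepD(2)[OF ind] ne by blast
  have TD: "s \<notin> D" if "s \<in> T" "s \<noteq> b" for s using free_indepD(2)[OF ind] that by blast
  have fixT: "g s = s" if s: "s \<in> T" "s \<noteq> b" for s
  proof (rule fixes_free)
    show "s \<in> M" "s \<noteq> b" "s \<notin> D" using s T_M TD by blast+
    show "free_indep rl {s} {b} D" by (rule free_indep_mono[OF ind]) (use s in auto)
  qed
  define ys where "ys = map g (map u (map t xs))"
  have "rl R ys" unfolding ys_def using rl_aut g uG t xs(1) by metis
  moreover have ys: "set ys = g ` T" unfolding ys_def T_def by (simp add: image_image)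
  moreover have "g ` T \<subseteq> T \<union> {b} \<union> insert (g b) D" using fixT by force
  ultimately have "g ` T \<subseteq> T \<union> {b} \<or> g ` T \<subseteq> {b} \<union> insert (g b) D"
    using free_indepD(1)[OF ind] by metis
  then show False
  proof
    assume "g ` T \<subseteq> T \<union> {b}"
    then show False using bT gbT ne by blast
  next
    assume *: "g ` T \<subseteq> {b} \<union> insert (g b) D"
    have "T = (u \<circ> t) ` set xs" unfolding T_def by (simp add: image_comp)
    moreover have "inj_on (u \<circ> t) (set xs)" by (rule inj_onI) (rule iffD1[OF eq_G[OF ut]])
    ultimately have "card T = card (set xs)" using card_image by blast
    then have "\<not> T \<subseteq> {b}" using xs(2) card_mono[of "{b}" T] by auto
    then obtain s where s: "s \<in> T" "s \<noteq> b" by blast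
    then have "s \<in> {b} \<union> insert (g b) D" using * fixT[OF s] by force
    then show False using s TD[OF s] gbT by blast
  qed
qed

lemma id_if_fixes_free:
  assumes g: "g \<in> G" and D: "fsub D"
    and fixes_free: "\<And>s. s \<in> M \<Longrightarrow> s \<notin> D \<Longrightarrow> free_indep rl {s} {} D \<Longrightarrow> g s = s"
  shows "g = id"
proof -
  have 1: "g b = b" if b: "b \<in> M" "b \<notin> D" for b
  proof (rule fix_if_fixes_free[OF g b(1) D])
    fix s assume s: "s \<in> M" "s \<notin> D" "s \<noteq> b" "free_indep rl {s} {b} D"
    have "free_indep rl {s} {} D" by (rule free_indep_shrink[OF s(4)]) (use s b in auto)
    then show "g s = s" using fixes_free s by blast
  qed
  have "g b = b" if b: "b \<in> M" for b
    by (rule fix_if_fixes_free[OF g b D]) (use 1 in blast)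
  then show ?thesis using G_eqI[OF g id_in] by simp
qed

section \<open>Every type of new points is moved\<close>

lemma orbit_disjoint:
  assumes "u \<in> stab D" "a \<notin> D"
  shows "u a \<notin> D"
proof
  assume *: "u a \<in> D"
  then have "u (u a) = u a" by (rule stab_fix[OF assms(1)])
  then have "u a = a" by (rule iffD1[OF eq_G[OF stab_G[OF assms(1)]]])
  then show False using * assms(2) by simp
qed

text \<open>A copy of \<open>a\<close> that is independent from \<open>P\<close> over
  \<open>D\<close> lies outside \<open>P\<close>, so an orbit over \<open>D\<close> of a point
  outside \<open>D\<close> can always be enlarged.\<close>

lemma infinite_orbit:
  assumes "fsub D" "a \<in> M" "a \<notin> D"
  shows "\<exists>P \<subseteq> (\<lambda>u. u a) ` stab D. fsub P \<and> card P = n"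
proof (induction n)
  case 0
  have "fsub {}" "card {} = 0" by simp_all
  then show ?case by blast
next
  case (Suc n)
  then obtain P where P: "P \<subseteq> (\<lambda>u. u a) ` stab D" "fsub P" "card P = n" by blast
  have "fsub {a}" using assms by simp
  then obtain u where u: "u \<in> stab D" "free_indep rl (u ` {a}) D P"
    using indep_ex assms(1) P(2) by blast
  have "u a \<notin> D" by (rule orbit_disjoint[OF u(1) assms(3)])
  then have ua: "u a \<notin> P" using free_indepD(2)[OF u(2)] by auto
  have fin: "finite P" using P(2) by (simp add: fsub_def)
  have "insert (u a) P \<subseteq> (\<lambda>u. u a) ` stab D" using P(1) u(1) by blast
  moreover have "fsub (insert (u a) P)" using P(2) in_M_G[OF stab_G[OF u(1)]] assms(2) by simp
  moreover have "card (insert (u a) P) = Suc n" using ua fin P(3) by simp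
  ultimately show ?case by blast
qed

text \<open>A relation on a set of least possible size \<open>n \<ge> 2\<close> is glued to \<open>n - 1\<close> realisations of the
  type of \<open>a\<close> over \<open>D\<close>: fewer than \<open>n\<close> points carry no relations except those of single points,
  so any \<open>n - 1\<close> points look alike. If \<open>g\<close> fixed all realisations, the remaining point of the
  relation could not be moved either.\<close>

lemma moves_type:
  assumes g: "g \<in> G" "g \<noteq> id" and D: "fsub D" and a: "a \<in> M" "a \<notin> D"
  shows "\<exists>u\<in>stab D. g (u a) \<noteq> u a"
proof (rule ccontr)
  assume "\<not> ?thesis"
  then have fixes_orbit: "g (u a) = u a" if "u \<in> stab D" for u using that by blast
  define n where "n = (LEAST n. 2 \<le> n \<and> (\<exists>R xs. rl R xs \<and> card (set xs) = n))"
  have "\<exists>n. 2 \<le> n \<and> (\<exists>R xs. rl R xs \<and> card (set xs) = n)" using nondegenerate by blast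
  from LeastI_ex[OF this] obtain R xs where n: "2 \<le> n" and xs: "rl R xs" "card (set xs) = n"
    unfolding n_def[symmetric] by blast
  have least: "n \<le> card (set ys)" if "rl R' ys" "2 \<le> card (set ys)" for R' ys
    unfolding n_def by (rule Least_le) (use that in blast)
  have xs_M: "set xs \<subseteq> M" by (rule rl_M[OF xs(1)])
  have "set xs \<noteq> {}" using xs(2) n by auto
  then obtain e where e: "e \<in> set xs" by (metis all_not_in_conv)
  define S where "S = set xs - {e}"
  have S: "finite S" "S \<subseteq> M" "card S = n - 1" "set xs = insert e S" "e \<notin> S"
    using e xs_M xs(2) by (auto simp: S_def)
  obtain P where P: "P \<subseteq> (\<lambda>u. u a) ` stab D" "fsub P" "card P = n - 1"
    using infinite_orbit[OF D a] by blast
  have P_fin: "finite P" "P \<subseteq> M" using P(2) by (simp_all add: fsub_def)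
  have PD: "P \<inter> D = {}" using P(1) orbit_disjoint a(2) by blast
  have "P \<noteq> {}" using P(3) n by auto
  obtain f where f: "bij_betw f S P" using finite_same_card_bij[OF S(1) P_fin(1)] S(3) P(3) by auto
  have "rl R' (map f ys) = rl R' ys" if ys: "set ys \<subseteq> S" for R' ys
  proof (cases "card (set ys) \<le> 1")
    case True
    moreover have "f ` set ys \<subseteq> M" using f ys P_fin(2) by (auto simp: bij_betw_def)
    ultimately show ?thesis using rl_degenerate[OF transitive, of ys f] ys S(2) by blast
  next
    case False
    have "card (f ` set ys) = card (set ys)"
      using f ys by (auto simp: bij_betw_def intro: card_image inj_on_subset)
    moreover have "card (set ys) \<le> n - 1" using card_mono[OF S(1) ys] S(3) by simp
    ultimately have "2 \<le> card (set ys)" "\<not> n \<le> card (set ys)"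
      "card (set (map f ys)) = card (set ys)"
      using False n unfolding set_map by linarith+
    then have "\<not> rl R' ys" "\<not> rl R' (map f ys)"
      using least[of R' ys] least[of R' "map f ys"] by presburger+
    then show ?thesis by blast
  qed
  moreover have "inj_on f S" "f ` S = P" using f by (simp_all add: bij_betw_def)
  ultimately obtain t where t: "t \<in> G" "\<forall>x\<in>S. t x = f x"
    using homogeneous[OF S(1,2), of f] P_fin(2) by blast
  have tS: "t ` S = P" using t(2) \<open>f ` S = P\<close> by (simp cong: image_cong)
  have teP: "t e \<notin> P" unfolding tS[symmetric] using S(5) eq_G[OF t(1)] by (metis imageE)
  have teM: "t e \<in> M" using in_M_G[OF t(1)] e xs_M by blast
  have "fsub {t e}" using teM by simp
  \<comment> \<open>The remaining point is placed freely from \<open>D\<close> over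
    \<open>P\<close>. As \<open>P\<close> avoids \<open>D\<close> and \<open>c\<close> avoids
    \<open>P\<close>, the base can be shrunk to the empty set.\<close>
  then obtain v where v: "v \<in> stab P" "free_indep rl (v ` {t e}) P D"
    using indep_ex P(2) D by blast
  have vG: "v \<in> G" using stab_G[OF v(1)] .
  define c where "c = v (t e)"
  have cP: "c \<notin> P" unfolding c_def by (rule orbit_disjoint[OF v(1) teP])
  have cM: "c \<in> M" unfolding c_def using in_M_G[OF vG] teM by blast
  have "free_indep rl {c} P D" using v(2) by (simp add: c_def)
  then have c_free: "free_indep rl {c} {} D"
    by (rule free_indep_shrink) (use PD cP in auto)
  have "g = id"
  proof (rule id_if_fixes_free[OF g(1)])
    \<comment> \<open>The preimage of \<open>D\<close> is added so that \<open>g b\<close> stays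
      outside \<open>D\<close>.\<close>
    show "fsub (D \<union> iv g ` D)" using D fsub_image[OF inv_in[OF g(1)]] by simp
    fix b assume b: "b \<in> M" "b \<notin> D \<union> iv g ` D" "free_indep rl {b} {} (D \<union> iv g ` D)"
    have b_free: "free_indep rl {b} {} D" by (rule free_indep_mono[OF b(3)]) auto
    have gbD: "g b \<notin> D" using b(2) inv_G(1)[OF g(1)] by (metis UnCI imageI)
    show "g b = b"
    proof (rule ccontr)
      assume ne: "g b \<noteq> b"
      \<comment> \<open>\<open>c\<close> and \<open>b\<close> have one type over the empty set by
        transitivity, and both are free from \<open>D\<close>. Stationarity yields \<open>w\<close>
        in \<open>stab D\<close> with \<open>w c = b\<close>, so \<open>b\<close> becomes the
        remaining point while \<open>w P\<close> still consists of realisations of the type of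
        \<open>a\<close>.\<close>
      obtain q where q: "q \<in> G" "q c = b" using transitive cM b(1) by blast
      have "q \<in> stab {}" by (rule stabI[OF q(1)]) simp
      moreover have "fsub {c}" "fsub {}" using cM by simp_all
      moreover have "free_indep rl (q ` {c}) {} D" using b_free q(2) by simp
      ultimately obtain w where w: "w \<in> stab ({} \<union> D)" "\<forall>x\<in>{c}. w x = q x"
        using stationary[of "{c}" "{}" D q] D c_free by blast
      have wD: "w \<in> stab D" and wc: "w c = b" using w q(2) by simp_all
      have wG: "w \<in> G" using stab_G[OF wD] .
      have "fsub (w ` P)" "fsub (insert b D)" "fsub {g b}"
        using fsub_image[OF wG] P(2) D b(1) in_M_G[OF g(1)] by simp_all
      then obtain z where z: "z \<in> stab (insert b D)" "free_indep rl (z ` w ` P) (insert b D) {g b}"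
        using indep_ex by blast
      have zG: "z \<in> G" using stab_G[OF z(1)] .
      \<comment> \<open>\<open>insert b Q\<close> carries the relation and \<open>g\<close> fixes
        \<open>Q\<close> pointwise, so \<open>insert (g b) Q\<close> carries it too. This
        contradicts the freeness of \<open>Q\<close> from \<open>g b\<close>.\<close>
      define Q where "Q = z ` w ` P"
      have Q: "free_indep rl Q (insert b D) {g b}" using z(2) by (simp add: Q_def)
      have Q_orbit: "\<exists>u\<in>stab D. s = u a" if s: "s \<in> Q" for s
      proof -
        obtain u where u: "u \<in> stab D" "s = z (w (u a))" using s P(1) unfolding Q_def by blast
        have "z \<in> stab D" by (rule stab_mono[OF z(1)]) blast
        then have "z \<circ> (w \<circ> u) \<in> stab D" using comp_stab wD u(1) by blast
        then show ?thesis using u(2) by (metis comp_apply)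
      qed
      have Q_fix: "g s = s" if "s \<in> Q" for s using Q_orbit[OF that] fixes_orbit by blast
      have QD: "s \<notin> D" if "s \<in> Q" for s using Q_orbit[OF that] orbit_disjoint a(2) by blast
      have zb: "z b = b" using stab_fix[OF z(1)] by blast
      have bQ: "b \<notin> Q"
      proof
        assume "b \<in> Q"
        then obtain s where s: "s \<in> P" "b = z (w s)" unfolding Q_def by blast
        then have "z (w s) = z (w c)" using zb wc by simp
        then have "s = c" using eq_G[OF zG] eq_G[OF wG] by metis
        then show False using s(1) cP by blast
      qed
      have gbQ: "g b \<notin> Q" using free_indepD(2)[OF Q] ne gbD by blast
      define ys where "ys = map g (map z (map w (map v (map t xs))))"
      have "rl R ys" unfolding ys_def using rl_aut g(1) zG wG vG t(1) xs(1) by metis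
      moreover have "set ys = insert (g b) Q"
      proof -
        have "v ` t ` set xs = insert c P"
          unfolding S(4) image_insert tS stab_image[OF v(1) subset_refl] c_def by (rule refl)
        then have *: "z ` w ` v ` t ` set xs = insert b Q" by (simp only: image_insert wc zb Q_def)
        have "g ` Q = Q" using Q_fix by force
        then show ?thesis unfolding ys_def set_map * image_insert by simp
      qed
      ultimately have "insert (g b) Q \<subseteq> Q \<union> insert b D \<or> insert (g b) Q \<subseteq> insert b D \<union> {g b}"
        using free_indepD(1)[OF Q, of R ys] by blast
      then show False
      proof
        assume "insert (g b) Q \<subseteq> Q \<union> insert b D"
        then show False using gbQ ne gbD by blast
      next
        assume *: "insert (g b) Q \<subseteq> insert b D \<union> {g b}"
        obtain s where "s \<in> Q" using \<open>P \<noteq> {}\<close> unfolding Q_def by blast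
        then show False using * QD bQ gbQ by blast
      qed
    qed
  qed
  then show False using g(2) by blast
qed

text \<open>Points are added one by one. A new point first avoids the image and the preimage of
  \<open>A'\<close> by freeness; it is then moved inside its type over a base containing these sets,
  so that it keeps avoiding them.\<close>

lemma moves_type_off:
  assumes g: "g \<in> G" "g \<noteq> id" and A: "fsub A" and B: "fsub B" and AB: "A \<inter> B = {}"
  shows "\<exists>u\<in>stab B. u ` A \<inter> g ` u ` A = {}"
proof -
  have "finite A" using A by (simp add: fsub_def)
  then show ?thesis using A AB
  proof (induction A rule: finite_induct)
    case empty
    have "id \<in> stab B" by simp
    then show ?case by blast
  next
    case (insert x A)
    then have A: "fsub A" "x \<in> M" "A \<inter> B = {}" "x \<notin> B" by auto
    then obtain u where u: "u \<in> stab B" "u ` A \<inter> g ` u ` A = {}" using insert.IH by blast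
    have uG: "u \<in> G" using stab_G[OF u(1)] .
    define A' where "A' = u ` A"
    have A': "fsub A'" unfolding A'_def using fsub_image[OF uG] A(1) by blast
    have gA': "fsub (g ` A')" "fsub (iv g ` A')"
      using fsub_image[OF g(1)] fsub_image[OF inv_in[OF g(1)]] A' by blast+
    have "u x \<notin> A'" unfolding A'_def using insert.hyps(2) eq_G[OF uG] by (metis imageE)
    then have ux: "u x \<notin> B \<union> A'" using orbit_disjoint[OF u(1) A(4)] by blast
    have uxM: "u x \<in> M" using in_M_G[OF uG] A(2) by blast
    have "fsub {u x}" "fsub (B \<union> A')" "fsub (g ` A' \<union> iv g ` A')" using uxM B A' gA' by simp_all
    then obtain v where v: "v \<in> stab (B \<union> A')"
      "free_indep rl (v ` {u x}) (B \<union> A') (g ` A' \<union> iv g ` A')"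
      using indep_ex by blast
    have vG: "v \<in> G" using stab_G[OF v(1)] .
    define D where "D = B \<union> A' \<union> g ` A' \<union> iv g ` A'"
    have D: "fsub D" unfolding D_def using B A' gA' by simp
    have "v (u x) \<notin> B \<union> A'" by (rule orbit_disjoint[OF v(1) ux])
    then have vux: "v (u x) \<notin> D" unfolding D_def using free_indepD(2)[OF v(2)] by blast
    have vuxM: "v (u x) \<in> M" using in_M_G[OF vG] uxM by blast
    obtain w where w: "w \<in> stab D" "g (w (v (u x))) \<noteq> w (v (u x))"
      using moves_type[OF g D vuxM vux] by blast
    define z where "z = w (v (u x))"
    have zD: "z \<notin> D" unfolding z_def by (rule orbit_disjoint[OF w(1) vux])
    have "g z \<notin> A'"
    proof
      assume "g z \<in> A'"
      then have "iv g (g z) \<in> iv g ` A'" by (rule imageI)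
      then show False using zD inv_G(1)[OF g(1)] unfolding D_def by simp
    qed
    moreover have "A' \<inter> g ` A' = {}" using u(2) unfolding A'_def .
    moreover have "z \<notin> g ` A'" using zD unfolding D_def by blast
    moreover have "z \<noteq> g z" using w(2) unfolding z_def by (rule not_sym)
    ultimately have disj: "insert z A' \<inter> g ` insert z A' = {}" unfolding image_insert by blast
    have "w ` v ` A' = A'"
      using stab_image[OF v(1), of A'] stab_image[OF w(1), of A'] unfolding D_def by auto
    then have "(w \<circ> (v \<circ> u)) ` insert x A = insert z A'"
      unfolding image_comp[symmetric] image_insert A'_def z_def by simp
    moreover have "w \<circ> (v \<circ> u) \<in> stab B"
      by (intro comp_stab stab_mono[OF w(1)] stab_mono[OF v(1)] u(1)) (auto simp: D_def)
    ultimately show ?case using disj by metis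
  qed
qed

lemma moves_type_generically:
  assumes g: "g \<in> G" "g \<noteq> id" and A: "fsub A" and B: "fsub B" and C: "fsub C" and AB: "A \<inter> B = {}"
  obtains u where "u \<in> stab B" "free_indep rl (u ` A) B C" "u ` A \<inter> g ` u ` A = {}"
    "u ` A \<inter> (B \<union> C) = {}"
proof -
  obtain u where u: "u \<in> stab B" "free_indep rl (u ` A) B C" using indep_ex[OF A B C] by blast
  have "u ` A \<inter> B = {}" using orbit_disjoint[OF u(1)] AB by blast
  then have uA: "u ` A \<inter> (B \<union> C) = {}" using free_indepD(2)[OF u(2)] by blast
  have "fsub (u ` A)" "fsub (B \<union> C)" using fsub_image[OF stab_G[OF u(1)]] A B C by simp_all
  then obtain v where v: "v \<in> stab (B \<union> C)" "v ` u ` A \<inter> g ` v ` u ` A = {}"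
    using moves_type_off[OF g _ _ uA] by blast
  have "free_indep rl (v ` u ` A) (v ` B) (v ` C)"
    by (rule indep_image[OF stab_G[OF v(1)] u(2)])
  moreover have "v ` B = B" "v ` C = C" by (rule stab_image[OF v(1)], blast)+
  ultimately have "free_indep rl ((v \<circ> u) ` A) B C" by (simp add: image_comp)
  moreover have "v \<circ> u \<in> stab B" by (rule comp_stab[OF stab_mono[OF v(1)] u(1)]) blast
  moreover have "(v \<circ> u) ` A \<inter> g ` (v \<circ> u) ` A = {}" using v(2) by (simp add: image_comp)
  moreover have "(v \<circ> u) ` A \<inter> (B \<union> C) = {}" using orbit_disjoint[OF v(1)] uA by fastforce
  ultimately show ?thesis using that by blast
qed

text \<open>Prolonging the finite approximation \<open>s\<close> on \<open>D\<close> of the conjugator \<open>h\<close> so as to settle the pair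
  \<open>A, B\<close>: a generic copy \<open>A'\<close> of \<open>A\<close> over \<open>B\<close> is moved by \<open>g\<close> to \<open>N\<close>, whose image \<open>h N = C\<close> is chosen
  such that \<open>g\<^sup>-\<^sup>1 C\<close> is new, so that \<open>h\<^sup>-\<^sup>1 g\<^sup>-\<^sup>1 C = K\<close> can be taken independent from \<open>A'\<close>.\<close>

lemma commutator_step:
  assumes g: "g \<in> G" "g \<noteq> id" and s: "s \<in> G" and D: "fsub D" and E: "fsub E"
    and A: "fsub A" and B: "fsub B" and AB: "A \<inter> B = {}"
  obtains s' D' where "s' \<in> G" "fsub D'" "D \<subseteq> D'" "E \<subseteq> D'" "E \<subseteq> s' ` D'" "\<forall>x\<in>D. s' x = s x"
    "\<forall>h\<in>G. (\<forall>x\<in>D'. h x = s' x) \<longrightarrow>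
       (\<exists>u\<in>stab B. free_indep rl (u ` A) B ((cj (iv g) h \<circ> g) ` (u ` A \<union> B)))"
proof -
  let ?g = "iv g"
  have g': "?g \<in> G" "?g \<noteq> id" using g inv_in inv_inv_G[OF g(1)] inv_id by metis+
  \<comment> \<open>The image of \<open>B\<close> under the commutator. It is final once
    \<open>h\<close> agrees with \<open>s\<close> on \<open>g B\<close> and on \<open>K0\<close>, so
    both sets go into \<open>D1\<close>.\<close>
  define K0 where "K0 = iv s ` ?g ` s ` g ` B"
  define D1 where "D1 = D \<union> B \<union> g ` B \<union> K0 \<union> E \<union> iv s ` E"
  have fs: "fsub (f ` S)" if "f \<in> G" "fsub S" for f S using fsub_image[OF that(1)] that(2) by blast
  have s': "iv s \<in> G" using s by blast
  have K0: "fsub K0" unfolding K0_def by (intro fs s' g'(1) s g(1) B)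
  have "fsub (g ` B)" "fsub (iv s ` E)" by (intro fs s' g(1) B E)+
  then have D1: "fsub D1" unfolding D1_def using D B E K0 by simp
  \<comment> \<open>Avoiding the preimage of \<open>D1\<close> as well ensures that
    \<open>N = g A'\<close> avoids \<open>D1\<close>, so the values on \<open>N\<close> are still
    open.\<close>
  have fC: "fsub (D1 \<union> ?g ` D1)" using D1 fs[OF g'(1) D1] by simp
  obtain u where u: "u \<in> stab B" "free_indep rl (u ` A) B (D1 \<union> ?g ` D1)"
    "u ` A \<inter> g ` u ` A = {}" "u ` A \<inter> (B \<union> (D1 \<union> ?g ` D1)) = {}"
    using moves_type_generically[OF g A B fC AB] .
  define A' where "A' = u ` A"
  define N where "N = g ` A'"
  have A': "fsub A'" unfolding A'_def by (rule fs[OF stab_G[OF u(1)] A])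
  have N: "fsub N" unfolding N_def by (rule fs[OF g(1) A'])
  have A'D1: "A' \<inter> D1 = {}" and A'N: "A' \<inter> N = {}"
    using u(3,4) unfolding A'_def N_def by blast+
  have ND1: "N \<inter> D1 = {}"
  proof -
    have "g a \<notin> D1" if "a \<in> A'" for a
    proof
      assume "g a \<in> D1"
      then have "?g (g a) \<in> ?g ` D1" by (rule imageI)
      then have "a \<in> ?g ` D1" using inv_G(1)[OF g(1)] by simp
      then show False using u(4) that unfolding A'_def by blast
    qed
    then show ?thesis unfolding N_def by blast
  qed
  have E1: "fsub (s ` D1)" "fsub (s ` N)" "fsub (g ` s ` D1)"
    by (intro fs s g(1) D1 N)+
  have "s ` N \<inter> s ` D1 = {}" using ND1 eq_G[OF s] by (auto simp: disjoint_iff)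
  \<comment> \<open>The values on \<open>N\<close> are moved over \<open>s D1\<close> until
    \<open>C\<close> is disjoint from \<open>?g C\<close>; this will make \<open>K\<close> disjoint
    from \<open>N\<close>.\<close>
  then obtain w where w: "w \<in> stab (s ` D1)" "w ` s ` N \<inter> ?g ` w ` s ` N = {}"
    "w ` s ` N \<inter> (s ` D1 \<union> g ` s ` D1) = {}"
    using moves_type_generically[OF g' E1(2,1,3)] by metis
  define s1 where "s1 = w \<circ> s"
  have s1: "s1 \<in> G" unfolding s1_def using stab_G[OF w(1)] s by blast
  have s1_D1: "s1 x = s x" if "x \<in> D1" for x
    unfolding s1_def o_apply by (rule stab_fix[OF w(1)]) (use that in blast)
  define C where "C = s1 ` N"
  have C: "C = w ` s ` N" by (simp add: C_def s1_def image_comp)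
  have C_new: "?g ` C \<inter> C = {}" "?g ` C \<inter> s ` D1 = {}"
  proof -
    show "?g ` C \<inter> C = {}" using w(2) unfolding C by blast
    have "?g c \<notin> s ` D1" if "c \<in> C" for c
    proof
      assume "?g c \<in> s ` D1"
      then have "g (?g c) \<in> g ` s ` D1" by (rule imageI)
      then have "c \<in> g ` s ` D1" using inv_G(2)[OF g(1)] by simp
      then show False using w(3) that unfolding C by blast
    qed
    then show "?g ` C \<inter> s ` D1 = {}" by blast
  qed
  have s1': "iv s1 \<in> G" using s1 by blast
  have fK: "fsub (iv s1 ` ?g ` C)" unfolding C_def by (intro fs s1' g'(1) s1 N)
  have D1N: "fsub (D1 \<union> N)" using D1 N by simp
  obtain v where v: "v \<in> stab (D1 \<union> N)" "free_indep rl (v ` iv s1 ` ?g ` C) (D1 \<union> N) A'"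
    using indep_ex[OF fK D1N A'] by blast
  have vG: "v \<in> G" using stab_G[OF v(1)] .
  define K where "K = v ` iv s1 ` ?g ` C"
  have K: "fsub K" unfolding K_def by (rule fs[OF vG fK])
  \<comment> \<open>Precomposing with \<open>iv v\<close> makes \<open>K\<close> the preimage of
    \<open>?g C\<close> and changes nothing on \<open>D1 \<union> N\<close>.\<close>
  define s2 where "s2 = s1 \<circ> iv v"
  have s2: "s2 \<in> G" unfolding s2_def using s1 vG by blast
  have s2_eq: "s2 x = s1 x" if "x \<in> D1 \<union> N" for x
    unfolding s2_def o_apply using stab_fix[OF inv_stab[OF v(1)] that] by simp
  have s2_D1: "s2 x = s x" if "x \<in> D1" for x using s2_eq[of x] s1_D1[OF that] that by simp
  have s2_N: "s2 ` N = C" unfolding C_def using s2_eq by (intro image_cong) auto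
  have s2_K: "s2 ` K = ?g ` C"
    unfolding K_def s2_def image_comp[symmetric] inv_image_G(1)[OF vG] inv_image_G(2)[OF s1] by (rule refl)
  have KN: "K \<inter> N = {}"
  proof -
    have "s2 ` (K \<inter> N) \<subseteq> ?g ` C \<inter> C" using s2_K s2_N by blast
    then show ?thesis using C_new(1) by blast
  qed
  have "free_indep rl K (D1 \<union> N) A'" using v(2) unfolding K_def .
  \<comment> \<open>\<open>v\<close> had to fix \<open>N\<close>, so it could free \<open>K\<close>
    from \<open>A'\<close> only over \<open>D1 \<union> N\<close>. Neither set meets
    \<open>N\<close>, and freeness permits dropping \<open>N\<close> from the base.\<close>
  then have "free_indep rl K D1 A'" by (rule free_indep_shrink) (use KN A'N in auto)
  then have ind1: "free_indep rl A' D1 K" by (rule indep_sym)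
  have "free_indep rl A' B D1" by (rule free_indep_mono[OF u(2)]) (auto simp: A'_def)
  moreover have "B \<union> D1 = D1" unfolding D1_def by blast
  ultimately have ind: "free_indep rl A' B (D1 \<union> K)" using indep_trans[of A' B D1 K] ind1 by simp
  show ?thesis
  proof (rule that[OF s2, of "D1 \<union> N \<union> K"])
    show "fsub (D1 \<union> N \<union> K)" using D1 N K by simp
    show "D \<subseteq> D1 \<union> N \<union> K" "E \<subseteq> D1 \<union> N \<union> K" unfolding D1_def by blast+
    have "s ` iv s ` E \<subseteq> s2 ` (D1 \<union> N \<union> K)"
    proof -
      have "s ` iv s ` E = s2 ` iv s ` E"
        by (rule image_cong[OF refl]) (rule s2_D1[symmetric], auto simp: D1_def)
      then show ?thesis unfolding D1_def by blast
    qed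
    then show "E \<subseteq> s2 ` (D1 \<union> N \<union> K)" unfolding inv_image_G(2)[OF s] .
    show "\<forall>x\<in>D. s2 x = s x" using s2_D1 unfolding D1_def by blast
    show "\<forall>h\<in>G. (\<forall>x\<in>D1 \<union> N \<union> K. h x = s2 x) \<longrightarrow>
      (\<exists>u\<in>stab B. free_indep rl (u ` A) B ((cj ?g h \<circ> g) ` (u ` A \<union> B)))"
    proof (intro ballI impI)
      fix h assume h: "h \<in> G" and agr: "\<forall>x\<in>D1 \<union> N \<union> K. h x = s2 x"
      let ?f = "cj ?g h \<circ> g"
      have fim: "?f ` S = iv h ` ?g ` h ` g ` S" for S by (simp add: cj_def image_comp)
      have "h ` N = C" unfolding s2_N[symmetric] using agr by (intro image_cong) auto
      moreover have "h ` K = ?g ` C" unfolding s2_K[symmetric] using agr by (intro image_cong) auto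
      ultimately have "?f ` A' = iv h ` h ` K" unfolding fim N_def[symmetric] by simp
      then have fA': "?f ` A' = K" using inv_image_G(1)[OF h] by simp
      have h_D1: "h ` S = s ` S" if "S \<subseteq> D1" for S
        using agr s2_D1 that by (intro image_cong) auto
      have "h ` g ` B = s ` g ` B" by (rule h_D1) (auto simp: D1_def)
      moreover have "?g ` s ` g ` B = s ` K0" unfolding K0_def inv_image_G(2)[OF s] by (rule refl)
      moreover have "h ` K0 = s ` K0" by (rule h_D1) (auto simp: D1_def)
      ultimately have "?f ` B = iv h ` h ` K0" unfolding fim by simp
      then have "?f ` B = K0" using inv_image_G(1)[OF h] by simp
      then have "?f ` (A' \<union> B) \<subseteq> D1 \<union> K" unfolding image_Un fA' D1_def by blast
      then have "free_indep rl A' B (?f ` (A' \<union> B))" using free_indep_mono[OF ind subset_refl] by blast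
      then show "\<exists>u\<in>stab B. free_indep rl (u ` A) B (?f ` (u ` A \<union> B))"
        using u(1) unfolding A'_def by blast
    qed
  qed
qed

text \<open>Points of \<open>A \<inter> B\<close> are fixed by \<open>stab B\<close>, so only
  \<open>A - B\<close> is put into general position. The images of the others lie in
  \<open>f B\<close>, which is why \<open>f B\<close> occurs on the right-hand side of the
  assumption.\<close>

lemma am_if_moves_disjoint:
  assumes f: "f \<in> G" and moves: "\<And>A B. fsub A \<Longrightarrow> fsub B \<Longrightarrow> A \<inter> B = {} \<Longrightarrow>
    \<exists>u\<in>stab B. free_indep rl (u ` A) B (f ` (u ` A \<union> B))"
  shows "am f"
  unfolding am_def
proof (intro conjI allI impI)
  show "f \<in> G" by (rule f)
  fix A B assume A: "fsub A" and B: "fsub B"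
  have A0: "fsub (A - B)" by (rule fsub_subset[OF A]) blast
  then obtain u where u: "u \<in> stab B" "free_indep rl (u ` (A - B)) B (f ` (u ` (A - B) \<union> B))"
    using moves[OF A0 B] by blast
  have "fsub (u ` (A - B))" using fsub_image[OF stab_G[OF u(1)]] A0 by blast
  then have fin: "fsub (u ` (A - B))" "fsub (f ` (u ` (A - B) \<union> B))"
    using fsub_image[OF f] B by simp_all
  have uA: "u ` A \<subseteq> u ` (A - B) \<union> B" using stab_image[OF u(1) subset_refl] by blast
  then have "f ` u ` A \<subseteq> B \<union> f ` (u ` (A - B) \<union> B)" by blast
  then have "free_indep rl (u ` A) B (f ` u ` A)"
    using indep_rebase[OF u(2) fin(1) B fin(2) uA subset_refl] by blast
  then show "\<exists>u\<in>stab B. free_indep rl (u ` A) B (f ` u ` A)" using u(1) by blast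
qed

text \<open>There are countably many pairs of finite sets, and stage \<open>n\<close> settles the
  pair with number \<open>n\<close>. As \<open>settled\<close> speaks of every \<open>h\<close> that
  extends the finite approximation, later stages cannot undo it.\<close>

theorem commutator_am:
  assumes g: "g \<in> G" "g \<noteq> id"
  obtains h where "h \<in> G" "am (cj (iv g) h \<circ> g)"
proof -
  define Prs where "Prs = {(A, B). fsub A \<and> fsub B \<and> A \<inter> B = {}}"
  have "countable {A. fsub A}"
    using countable_Collect_finite_subset[OF countable_carrier] by (simp add: fsub_def conj_commute)
  then have "countable ({A. fsub A} \<times> {A. fsub A})" by (intro countable_SIGMA)
  then have Prs: "countable Prs" by (rule countable_subset[rotated]) (auto simp: Prs_def)
  \<comment> \<open>Nonemptiness makes every value of \<open>from_nat_into\<close> a member of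
    \<open>Prs\<close>.\<close>
  have "({}, {}) \<in> Prs" by (simp add: Prs_def)
  then have "from_nat_into Prs n \<in> Prs" for n by (intro from_nat_into) auto
  then have P: "fsub (fst (from_nat_into Prs n))" "fsub (snd (from_nat_into Prs n))"
    "fst (from_nat_into Prs n) \<inter> snd (from_nat_into Prs n) = {}" for n
    by (auto simp: Prs_def split_beta)
  define E where "E n = {from_nat_into M n} \<inter> M" for n
  have E: "fsub (E n)" for n unfolding E_def fsub_def by auto
  define settled where "settled s D A B \<longleftrightarrow> (\<forall>h\<in>G. (\<forall>x\<in>D. h x = s x) \<longrightarrow>
    (\<exists>u\<in>stab B. free_indep rl (u ` A) B ((cj (iv g) h \<circ> g) ` (u ` A \<union> B))))" for s D A B
  define ext where "ext = (\<lambda>n (s, D) (s', D'). D \<subseteq> D' \<and> E n \<subseteq> D' \<and> E n \<subseteq> s' ` D' \<and>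
    (\<forall>x\<in>D. s' x = s x) \<and>
    settled s' D' (fst (from_nat_into Prs n)) (snd (from_nat_into Prs n)))"
  define st where "st = (\<lambda>(s, D). s \<in> G \<and> fsub D)"
  have "st (id, {})" by (simp add: st_def)
  moreover have "\<exists>q. st q \<and> ext n p q" if p: "st p" for p n
  proof -
    obtain s D where sD: "p = (s, D)" by (cases p)
    then have sG: "s \<in> G" and Df: "fsub D" using p by (simp_all add: st_def)
    obtain s' D' where s': "s' \<in> G" "fsub D'" "D \<subseteq> D'" "E n \<subseteq> D'" "E n \<subseteq> s' ` D'"
      "\<forall>x\<in>D. s' x = s x" "settled s' D' (fst (from_nat_into Prs n)) (snd (from_nat_into Prs n))"
      using commutator_step[OF g sG Df E[of n] P[of n], folded settled_def] .
    from s' have "st (s', D')" "ext n p (s', D')" unfolding st_def ext_def sD by simp_all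
    then show ?thesis by blast
  qed
  ultimately obtain f where f: "\<And>n. st (f n)" "\<And>n. ext n (f n) (f (Suc n))"
    using dependent_nat_choice[of "\<lambda>_. st" ext] by metis
  define s where "s n = fst (f n)" for n
  define D where "D n = snd (f n)" for n
  have st: "s n \<in> G" "fsub (D n)" for n
    using f(1)[of n] by (simp_all add: st_def s_def D_def split_beta)
  have ext: "D n \<subseteq> D (Suc n)" "E n \<subseteq> D (Suc n)" "E n \<subseteq> s (Suc n) ` D (Suc n)"
    "\<forall>x\<in>D n. s (Suc n) x = s n x"
    "settled (s (Suc n)) (D (Suc n)) (fst (from_nat_into Prs n)) (snd (from_nat_into Prs n))" for n
    using f(2)[of n] by (simp_all add: ext_def s_def D_def split_beta)
  have Ex: "\<exists>n. x \<in> E n" if "x \<in> M" for x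
    using from_nat_into_surj[OF countable_carrier that] that unfolding E_def by auto
  have "\<exists>h\<in>G. \<forall>n. \<forall>x\<in>D n. h x = s n x"
  proof (rule limit)
    fix n show "s n \<in> G" "D n \<subseteq> D (Suc n)" by (rule st ext)+
    show "D n \<subseteq> M" using st(2)[of n] by (simp add: fsub_def)
    show "s (Suc n) x = s n x" if "x \<in> D n" for x using ext(4) that by blast
  next
    fix x assume "x \<in> M"
    then obtain n where "x \<in> E n" using Ex by blast
    then show "\<exists>n. x \<in> D n" "\<exists>n. x \<in> s n ` D n" using ext(2,3)[of n] by blast+
  qed
  then obtain h where h: "h \<in> G" "\<And>n x. x \<in> D n \<Longrightarrow> h x = s n x" by blast
  have "am (cj (iv g) h \<circ> g)"
  proof (rule am_if_moves_disjoint)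
    show "cj (iv g) h \<circ> g \<in> G" using g(1) h(1) by blast
    fix A B assume "fsub A" "fsub B" "A \<inter> B = {}"
    then have "(A, B) \<in> Prs" by (simp add: Prs_def)
    then obtain n where "from_nat_into Prs n = (A, B)" using from_nat_into_surj[OF Prs] by blast
    then have "settled (s (Suc n)) (D (Suc n)) A B" using ext(5)[of n] by simp
    then show "\<exists>u\<in>stab B. free_indep rl (u ` A) B ((cj (iv g) h \<circ> g) ` (u ` A \<union> B))"
      using h unfolding settled_def by blast
  qed
  then show ?thesis using that h(1) by blast
qed

section \<open>Counting conjugates of \<open>g\<close> and of its inverse\<close>

definition conj_products :: "('a \<Rightarrow> 'a) \<Rightarrow> nat \<Rightarrow> ('a \<Rightarrow> 'a) set" where
  "conj_products g n = {foldr (\<circ>) ps id | ps. length ps = n \<and>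
     set ps \<subseteq> cj g ` G \<union> cj (iv g) ` G}"

lemma conj_products_comp:
  assumes "x \<in> conj_products g m" "y \<in> conj_products g n"
  shows "x \<circ> y \<in> conj_products g (m + n)"
proof -
  obtain ps qs where ps: "x = foldr (\<circ>) ps id" "length ps = m" "set ps \<subseteq> cj g ` G \<union> cj (iv g) ` G"
    and qs: "y = foldr (\<circ>) qs id" "length qs = n" "set qs \<subseteq> cj g ` G \<union> cj (iv g) ` G"
    using assms unfolding conj_products_def by blast
  have fold: "foldr (\<circ>) ps z = foldr (\<circ>) ps id \<circ> z" for z :: "'a \<Rightarrow> 'a"
    by (induction ps) (simp_all add: o_assoc)
  have "x \<circ> y = foldr (\<circ>) (ps @ qs) id"
    using fold[of "foldr (\<circ>) qs id"] unfolding ps(1) qs(1) by (metis foldr_append comp_apply)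
  moreover have "length (ps @ qs) = m + n" "set (ps @ qs) \<subseteq> cj g ` G \<union> cj (iv g) ` G"
    using ps qs by auto
  ultimately show ?thesis unfolding conj_products_def by blast
qed

lemma conj_products_one:
  assumes "x \<in> cj g ` G \<union> cj (iv g) ` G"
  shows "x \<in> conj_products g 1"
proof -
  have "x = foldr (\<circ>) [x] id" "length [x] = 1" "set [x] \<subseteq> cj g ` G \<union> cj (iv g) ` G"
    using assms by auto
  then show ?thesis unfolding conj_products_def by blast
qed

theorem conj_products_16:
  assumes g: "g \<in> G" "g \<noteq> id" and h: "h \<in> G"
  shows "h \<in> conj_products g 16"
proof -
  obtain k where k: "k \<in> G" "am (cj (iv g) k \<circ> g)" using commutator_am[OF g] .
  define f where "f = cj (iv g) k \<circ> g"
  have f: "am f" "f \<in> G" using k(2) am_G unfolding f_def by blast+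
  have g': "iv g \<in> G" using g by blast
  obtain c d where cd: "\<forall>i. c i \<in> G" "\<forall>i. d i \<in> G" "pth f c 4 = h \<circ> pth f d 4"
    using am_product[OF f(1) h] .
  have two: "cj f u \<in> conj_products g 2" "iv (cj f u) \<in> conj_products g 2" if u: "u \<in> G" for u
  proof -
    \<comment> \<open>Conjugation by \<open>u\<close> splits the commutator into a conjugate of the
      inverse of \<open>g\<close> and one of \<open>g\<close>. Inversion exchanges the two kinds, so
      the inverse costs two factors as well.\<close>
    have eq: "cj f u = cj (iv g) (k \<circ> u) \<circ> cj g u"
      unfolding cj_comp[OF k(1) u] f_def using inv_G(2)[OF u] by (simp add: cj_def fun_eq_iff)
    have 1: "cj (iv g) (k \<circ> u) \<in> conj_products g 1" "cj g u \<in> conj_products g 1"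
      by (intro conj_products_one UnI2 imageI comp_in k(1) u)
         (intro conj_products_one UnI1 imageI u)
    have ku: "k \<circ> u \<in> G" using k(1) u by blast
    have "iv (cj f u) = cj (iv g) u \<circ> cj g (k \<circ> u)"
      unfolding eq inv_comp_G[OF cj_G[OF g' ku] cj_G[OF g(1) u]] inv_cj[OF g(1) u] inv_cj[OF g' ku]
        inv_inv_G[OF g(1)] by (rule refl)
    moreover have "cj (iv g) u \<in> conj_products g 1" "cj g (k \<circ> u) \<in> conj_products g 1"
      by (intro conj_products_one UnI2 imageI u) (intro conj_products_one UnI1 imageI ku)
    ultimately have "iv (cj f u) \<in> conj_products g (1 + 1)" using conj_products_comp by metis
    moreover have "cj f u \<in> conj_products g (1 + 1)" using conj_products_comp[OF 1] eq by metis
    ultimately show "cj f u \<in> conj_products g 2" "iv (cj f u) \<in> conj_products g 2"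
      by (simp_all only: one_add_one)
  qed
  have base: "id \<in> conj_products g 0" by (simp add: conj_products_def)
  have pth: "pth f c n \<in> conj_products g (2 * n)" for n
  proof (induction n)
    case 0 show ?case unfolding pth.simps mult_0_right by (rule base)
  next
    case (Suc n)
    have "cj f (c n) \<circ> pth f c n \<in> conj_products g (2 + 2 * n)"
      using conj_products_comp two(1) Suc cd(1) by blast
    then show ?case by (simp only: pth.simps mult_Suc_right)
  qed
  have inv_pth: "iv (pth f d n) \<in> conj_products g (2 * n)" for n
  proof (induction n)
    case 0 show ?case unfolding pth.simps inv_id mult_0_right by (rule base)
  next
    case (Suc n)
    have "iv (pth f d n) \<circ> iv (cj f (d n)) \<in> conj_products g (2 * n + 2)"
      using conj_products_comp two(2) Suc cd(2) by blast
    moreover have "iv (pth f d (Suc n)) = iv (pth f d n) \<circ> iv (cj f (d n))"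
      unfolding pth.simps
      by (rule inv_comp_G[OF cj_G[OF f(2)] pth_G[OF f(2) cd(2)]]) (use cd(2) in blast)
    ultimately show ?case by (simp only: mult_Suc_right add.commute)
  qed
  have "h = pth f c 4 \<circ> iv (pth f d 4)"
    unfolding cd(3) using inv_G(2)[OF pth_G[OF f(2) cd(2)]] by (simp add: fun_eq_iff)
  moreover have "pth f c 4 \<circ> iv (pth f d 4) \<in> conj_products g (2 * 4 + 2 * 4)"
    by (rule conj_products_comp[OF pth inv_pth])
  ultimately show ?thesis by simp
qed

end

section \<open>Automorphisms of the limit\<close>

lemma restrict_autg:
  assumes "p \<in> autg (carrier M) (rel M)"
  shows "restrict p (carrier M) \<in> carrier (Aut M)"
proof -
  let ?S = "carrier M"
  have p: "p permutes ?S" "\<And>R xs. rel M R (map p xs) = rel M R xs" using assms by (auto simp: autg_def)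
  have bij: "bij_betw (restrict p ?S) ?S ?S" using permutes_imp_bij[OF p(1)] by simp
  have "rel M R xs = rel M R (map (restrict p ?S) xs)" if "set xs \<subseteq> ?S" for R xs
  proof -
    have "map (restrict p ?S) xs = map p xs" using that by auto
    then show ?thesis using p(2) by metis
  qed
  then show ?thesis using bij by (simp add: Aut_def Bij_def struct_iso_def)
qed

lemma extend_Aut:
  assumes M: "structure_for L ar M" and f: "f \<in> carrier (Aut M)"
  obtains p where "p \<in> autg (carrier M) (rel M)" "restrict p (carrier M) = f"
    "\<And>x. x \<in> carrier M \<Longrightarrow> p x = f x"
proof -
  let ?S = "carrier M"
  define p where "p x = (if x \<in> ?S then f x else x)" for x
  have f': "f \<in> extensional ?S" "bij_betw f ?S ?S" "struct_iso f M M"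
    using f by (auto simp: Aut_def Bij_def)
  have "bij_betw p ?S ?S" using f'(2) by (rule bij_betw_cong[THEN iffD1, rotated]) (simp add: p_def)
  then have p: "p permutes ?S" by (rule bij_imp_permutes) (simp add: p_def)
  have "rel M R (map p xs) = rel M R xs" for R xs
  proof (cases "set xs \<subseteq> ?S")
    case True
    then have "map p xs = map f xs" by (auto simp: p_def)
    then show ?thesis using f'(3) True unfolding struct_iso_def by metis
  next
    case False
    then have "\<not> set (map p xs) \<subseteq> ?S" using permutes_in_image[OF p] by auto
    then show ?thesis using False M unfolding structure_for_def by blast
  qed
  then have "p \<in> autg ?S (rel M)" using p by (simp add: autg_def)
  moreover have "restrict p ?S = f" using f'(1) by (auto simp: p_def restrict_def extensional_def)
  ultimately show ?thesis using that by (simp add: p_def)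
qed

section \<open>Finite substructures and their copies on the natural numbers\<close>

lemma carrier_induced [simp]: "carrier (induced A S) = S"
  by (simp add: induced_def)

lemma rel_induced: "rel (induced A S) R xs \<longleftrightarrow> set xs \<subseteq> S \<and> rel A R xs"
  by (simp add: induced_def)

lemma substructure_induced: "S \<subseteq> carrier A \<Longrightarrow> substructure (induced A S) A"
  by (simp add: substructure_def)

lemma substructure_rel:
  assumes "substructure B A" "set xs \<subseteq> carrier B"
  shows "rel B R xs = rel A R xs"
proof -
  have "B = induced A (carrier B)" using assms(1) by (simp add: substructure_def)
  then have "rel B R xs = rel (induced A (carrier B)) R xs" by simp
  then show ?thesis using assms(2) by (simp add: rel_induced)
qed

definition copy :: "('a, 'r) relstr \<Rightarrow> ('a \<Rightarrow> 'b) \<Rightarrow> 'a set \<Rightarrow> ('b, 'r) relstr" where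
  "copy A f S = \<lparr>carrier = f ` S, rel = (\<lambda>R ys. \<exists>xs. set xs \<subseteq> S \<and> ys = map f xs \<and> rel A R xs)\<rparr>"

lemma carrier_copy [simp]: "carrier (copy A f S) = f ` S"
  by (simp add: copy_def)

lemma rel_copy:
  assumes "inj_on f S" "set xs \<subseteq> S"
  shows "rel (copy A f S) R (map f xs) = rel A R xs"
proof -
  have "xs = ys" if "set ys \<subseteq> S" "map f xs = map f ys" for ys
  proof (rule map_inj_on[OF that(2)])
    show "inj_on f (set xs \<union> set ys)" using assms that(1) by (auto intro: inj_on_subset)
  qed
  then show ?thesis using assms(2) unfolding copy_def by auto
qed

lemma lift_list: "set ys \<subseteq> f ` S \<Longrightarrow> \<exists>xs. set xs \<subseteq> S \<and> ys = map f xs"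
proof (induction ys)
  case Nil
  then show ?case by simp
next
  case (Cons y ys)
  then obtain xs where "set xs \<subseteq> S" "ys = map f xs" by (meson set_subset_Cons subset_trans)
  moreover obtain x where "x \<in> S" "y = f x" using Cons.prems by auto
  ultimately have "set (x # xs) \<subseteq> S \<and> y # ys = map f (x # xs)" by simp
  then show ?case by (rule exI)
qed

locale fraisse_limit_of_free_class =
  fixes L :: "'r set" and ar :: "'r \<Rightarrow> nat" and \<C> :: "(nat, 'r) relstr set"
    and M :: "('a, 'r) relstr"
  assumes free_class: "free_amalgamation_class L ar \<C>" and limit: "fraisse_limit L ar \<C> M"
begin

lemma structure_M: "structure_for L ar M" and countable_M: "countable (carrier M)"
  using limit by (simp_all add: fraisse_limit_def)

lemma homogeneous_M:
  assumes "finite S" "S \<subseteq> carrier M" "inj_on f S" "f ` S \<subseteq> carrier M"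
    and iso: "\<And>R xs. set xs \<subseteq> S \<Longrightarrow> rel M R (map f xs) = rel M R xs"
  shows "\<exists>g\<in>autg (carrier M) (rel M). \<forall>x\<in>S. g x = f x"
proof -
  have "struct_iso f (induced M S) (induced M (f ` S))"
    unfolding struct_iso_def using assms(3) iso by (auto simp: rel_induced bij_betw_def)
  moreover have "substructure (induced M S) M" "substructure (induced M (f ` S)) M"
    using assms(2,4) by (auto intro: substructure_induced)
  moreover have "finite (carrier (induced M S))" "finite (carrier (induced M (f ` S)))"
    using assms(1) by simp_all
  ultimately have "\<exists>g\<in>carrier (Aut M). \<forall>x\<in>carrier (induced M S). g x = f x"
    using limit unfolding fraisse_limit_def by blast
  then obtain g where g: "g \<in> carrier (Aut M)" "\<forall>x\<in>S. g x = f x" by auto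
  obtain p where "p \<in> autg (carrier M) (rel M)" "\<And>x. x \<in> carrier M \<Longrightarrow> p x = g x"
    using extend_Aut[OF structure_M g(1)] by metis
  then show ?thesis using g(2) assms(2) by (metis subsetD)
qed

text \<open>Every finite substructure of \<open>M\<close> is isomorphic to a member of the class,
  which is closed under isomorphism; so the points of the copy may be named freely.\<close>

lemma copy_in_class:
  assumes S: "finite S" "S \<subseteq> carrier M" and f: "inj_on f S"
  shows "copy M f S \<in> \<C>"
proof -
  have "substructure (induced M S) M" "finite (carrier (induced M S))"
    using S by (simp_all add: substructure_induced)
  then obtain A g where A: "A \<in> \<C>" and g: "struct_iso g A (induced M S)"
    using limit unfolding fraisse_limit_def isomorphic_def by meson
  have bij: "bij_betw g (carrier A) S" using g by (simp add: struct_iso_def)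
  have "rel A R xs = rel (copy M f S) R (map (f \<circ> g) xs)" if xs: "set xs \<subseteq> carrier A" for R xs
  proof -
    have gS: "set (map g xs) \<subseteq> S" using xs bij by (auto simp: bij_betw_def)
    have "rel A R xs = rel (induced M S) R (map g xs)" using g xs unfolding struct_iso_def by blast
    also have "\<dots> = rel M R (map g xs)" using gS by (simp add: rel_induced)
    also have "\<dots> = rel (copy M f S) R (map f (map g xs))" by (rule rel_copy[OF f gS, symmetric])
    finally show ?thesis by simp
  qed
  moreover have "bij_betw (f \<circ> g) (carrier A) (f ` S)"
    by (rule bij_betw_trans[OF bij]) (use f in \<open>simp add: bij_betw_def\<close>)
  ultimately have "isomorphic A (copy M f S)"
    unfolding isomorphic_def struct_iso_def by (metis carrier_copy)
  moreover have "structure_for L ar (copy M f S)"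
    using structure_M unfolding structure_for_def copy_def by fastforce
  ultimately show ?thesis using free_class A unfolding free_amalgamation_class_def by blast
qed

text \<open>Copies of \<open>A \<union> B\<close> and \<open>B \<union> C\<close> that share only
  \<open>B\<close> are amalgamated freely and embedded into \<open>M\<close>. Homogeneity returns
  the embedded \<open>B \<union> C\<close> to its place by \<open>t\<close>, and then identifies
  \<open>A \<union> B\<close> with the copy found there by \<open>u\<close>.\<close>

lemma free_extension_M:
  assumes A: "finite A" "A \<subseteq> carrier M" and B: "finite B" "B \<subseteq> carrier M"
    and C: "finite C" "C \<subseteq> carrier M"
  shows "\<exists>u\<in>autg (carrier M) (rel M). (\<forall>x\<in>B. u x = x) \<and> free_indep (rel M) (u ` A) B C"
proof -
  define e where "e = to_nat_on (carrier M)"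
  have e: "x = y" if "e x = e y" "x \<in> carrier M" "y \<in> carrier M" for x y
    using inj_on_to_nat_on[OF countable_M] that unfolding e_def inj_on_def by blast
  \<comment> \<open>Even numbers name \<open>B \<union> C\<close>, odd numbers the points of
    \<open>A\<close> outside \<open>B\<close>. Thus the copies meet exactly in \<open>B\<close>,
    even when \<open>A\<close> and \<open>C\<close> share further points.\<close>
  define \<alpha> where "\<alpha> x = (if x \<in> B then 2 * e x else Suc (2 * e x))" for x
  define \<gamma> where "\<gamma> x = 2 * e x" for x
  have \<alpha>B: "\<alpha> x = \<gamma> x" if "x \<in> B" for x using that by (simp add: \<alpha>_def \<gamma>_def)
  have \<alpha>\<gamma>: "x \<in> B \<and> x = y" if "\<alpha> x = \<gamma> y" "x \<in> A \<union> B" "y \<in> B \<union> C" for x y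
  proof -
    have "x \<in> B" using that(1) by (auto simp: \<alpha>_def \<gamma>_def split: if_splits; presburger)
    moreover from this have "e x = e y" using that(1) by (simp add: \<alpha>_def \<gamma>_def)
    ultimately show ?thesis using e that(2,3) A(2) B(2) C(2) by blast
  qed
  have inj\<alpha>: "inj_on \<alpha> (A \<union> B)"
  proof (rule inj_onI)
    fix x y assume "x \<in> A \<union> B" "y \<in> A \<union> B" "\<alpha> x = \<alpha> y"
    moreover from this(3) have "e x = e y" by (auto simp: \<alpha>_def split: if_splits; presburger)
    ultimately show "x = y" using e A(2) B(2) by blast
  qed
  have inj\<gamma>: "inj_on \<gamma> (B \<union> C)"
  proof (rule inj_onI)
    fix x y assume "x \<in> B \<union> C" "y \<in> B \<union> C" "\<gamma> x = \<gamma> y"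
    then show "x = y" using e B(2) C(2) by (auto simp: \<gamma>_def)
  qed
  let ?A = "copy M \<alpha> (A \<union> B)" and ?C = "copy M \<gamma> (B \<union> C)"
  have cls: "?A \<in> \<C>" "?C \<in> \<C>"
    using copy_in_class inj\<alpha> inj\<gamma> A B C by simp_all
  have cap: "carrier ?A \<inter> carrier ?C = \<gamma> ` B"
    unfolding carrier_copy
  proof (intro equalityI subsetI)
    fix n assume "n \<in> \<alpha> ` (A \<union> B) \<inter> \<gamma> ` (B \<union> C)"
    then obtain x y where "x \<in> A \<union> B" "y \<in> B \<union> C" "n = \<alpha> x" "n = \<gamma> y" by blast
    then show "n \<in> \<gamma> ` B" using \<alpha>\<gamma>[of x y] by (metis imageI)
  next
    fix n assume "n \<in> \<gamma> ` B"
    then obtain x where "x \<in> B" "n = \<gamma> x" by blast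
    then show "n \<in> \<alpha> ` (A \<union> B) \<inter> \<gamma> ` (B \<union> C)" using \<alpha>B[of x] by (metis IntI UnI1 UnI2 imageI)
  qed
  have "rel (induced ?A (\<gamma> ` B)) R ys = rel (induced ?C (\<gamma> ` B)) R ys" for R ys
  proof (cases "set ys \<subseteq> \<gamma> ` B")
    case True
    then obtain xs where xs: "set xs \<subseteq> B" "ys = map \<gamma> xs" using lift_list by metis
    have sub: "set xs \<subseteq> A \<union> B" "set xs \<subseteq> B \<union> C" using xs(1) by blast+
    have "ys = map \<alpha> xs" unfolding xs(2) by (rule map_cong[OF refl]) (use \<alpha>B xs(1) in auto)
    then have "rel ?A R ys = rel M R xs" using rel_copy[OF inj\<alpha> sub(1)] by metis
    also have "\<dots> = rel ?C R ys" using rel_copy[OF inj\<gamma> sub(2)] xs(2) by metis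
    finally show ?thesis by (simp add: rel_induced)
  next
    case False
    then show ?thesis by (simp add: rel_induced)
  qed
  then have "induced ?A (carrier ?A \<inter> carrier ?C) = induced ?C (carrier ?A \<inter> carrier ?C)"
    unfolding cap by (auto intro!: relstr.equality simp: fun_eq_iff)
  then obtain D where D: "D \<in> \<C>" "free_amalgam L ar ?A ?C D"
    using free_class cls unfolding free_amalgamation_class_def by blast
  have D_carrier: "carrier D = \<alpha> ` (A \<union> B) \<union> \<gamma> ` (B \<union> C)"
    and subs: "substructure ?A D" "substructure ?C D"
    and D_free: "\<And>R ds. rel D R ds \<Longrightarrow> set ds \<subseteq> \<alpha> ` (A \<union> B) \<or> set ds \<subseteq> \<gamma> ` (B \<union> C)"
    using D(2) by (simp_all add: free_amalgam_def)
  obtain D' \<phi> where D': "substructure D' M" and \<phi>: "struct_iso \<phi> D D'"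
    using limit D(1) unfolding fraisse_limit_def isomorphic_def by meson
  have \<phi>_bij: "bij_betw \<phi> (carrier D) (carrier D')" using \<phi> by (simp add: struct_iso_def)
  have \<phi>_inj: "inj_on \<phi> (carrier D)" using \<phi>_bij by (simp add: bij_betw_def)
  have \<phi>M: "\<phi> d \<in> carrier M" if "d \<in> carrier D" for d
    using \<phi>_bij D' that by (auto simp: bij_betw_def substructure_def)
  have \<phi>_rel: "rel M R (map \<phi> ds) = rel D R ds" if "set ds \<subseteq> carrier D" for R ds
  proof -
    have "rel D R ds = rel D' R (map \<phi> ds)" using \<phi> that unfolding struct_iso_def by blast
    also have "\<dots> = rel M R (map \<phi> ds)"
      by (rule substructure_rel[OF D']) (use \<phi>_bij that in \<open>auto simp: bij_betw_def\<close>)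
    finally show ?thesis by simp
  qed
  have \<phi>\<alpha>_rel: "rel M R (map (\<phi> \<circ> \<alpha>) xs) = rel M R xs" if xs: "set xs \<subseteq> A \<union> B" for R xs
  proof -
    have im: "set (map \<alpha> xs) \<subseteq> \<alpha> ` (A \<union> B)" using xs by auto
    then have "rel M R (map \<phi> (map \<alpha> xs)) = rel D R (map \<alpha> xs)" using D_carrier by (intro \<phi>_rel) blast
    also have "\<dots> = rel ?A R (map \<alpha> xs)" using substructure_rel[OF subs(1)] im by simp
    also have "\<dots> = rel M R xs" by (rule rel_copy[OF inj\<alpha> xs])
    finally show ?thesis by simp
  qed
  have \<phi>\<gamma>_rel: "rel M R (map (\<phi> \<circ> \<gamma>) xs) = rel M R xs" if xs: "set xs \<subseteq> B \<union> C" for R xs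
  proof -
    have im: "set (map \<gamma> xs) \<subseteq> \<gamma> ` (B \<union> C)" using xs by auto
    then have "rel M R (map \<phi> (map \<gamma> xs)) = rel D R (map \<gamma> xs)" using D_carrier by (intro \<phi>_rel) blast
    also have "\<dots> = rel ?C R (map \<gamma> xs)" using substructure_rel[OF subs(2)] im by simp
    also have "\<dots> = rel M R xs" by (rule rel_copy[OF inj\<gamma> xs])
    finally show ?thesis by simp
  qed
  have inj\<phi>\<alpha>: "inj_on (\<phi> \<circ> \<alpha>) (A \<union> B)"
    by (rule comp_inj_on[OF inj\<alpha> inj_on_subset[OF \<phi>_inj]]) (simp add: D_carrier)
  have inj\<phi>\<gamma>: "inj_on (\<phi> \<circ> \<gamma>) (B \<union> C)"
    by (rule comp_inj_on[OF inj\<gamma> inj_on_subset[OF \<phi>_inj]]) (simp add: D_carrier)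
  define f where "f = inv_into (B \<union> C) (\<phi> \<circ> \<gamma>)"
  have f: "f (\<phi> (\<gamma> x)) = x" if "x \<in> B \<union> C" for x
    using inv_into_f_f[OF inj\<phi>\<gamma> that] by (simp add: f_def)
  have "\<exists>t\<in>autg (carrier M) (rel M). \<forall>x\<in>(\<phi> \<circ> \<gamma>) ` (B \<union> C). t x = f x"
  proof (rule homogeneous_M)
    show "finite ((\<phi> \<circ> \<gamma>) ` (B \<union> C))" using B C by simp
    show "(\<phi> \<circ> \<gamma>) ` (B \<union> C) \<subseteq> carrier M" using \<phi>M D_carrier by auto
    show "inj_on f ((\<phi> \<circ> \<gamma>) ` (B \<union> C))" unfolding f_def by (rule inj_on_inv_into) simp
    show "f ` (\<phi> \<circ> \<gamma>) ` (B \<union> C) \<subseteq> carrier M" using f B(2) C(2) by auto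
    fix R ys assume "set ys \<subseteq> (\<phi> \<circ> \<gamma>) ` (B \<union> C)"
    then obtain xs where xs: "set xs \<subseteq> B \<union> C" "ys = map (\<phi> \<circ> \<gamma>) xs" using lift_list by metis
    have "map f ys = xs" unfolding xs(2) map_map by (rule map_idI) (use f xs(1) in auto)
    then show "rel M R (map f ys) = rel M R ys" using \<phi>\<gamma>_rel[OF xs(1)] xs(2) by simp
  qed
  then obtain t where t: "t \<in> autg (carrier M) (rel M)" and tf: "\<forall>x\<in>(\<phi> \<circ> \<gamma>) ` (B \<union> C). t x = f x"
    by blast
  have t\<gamma>: "t (\<phi> (\<gamma> x)) = x" if "x \<in> B \<union> C" for x using tf f that by simp
  have t_perm: "t permutes carrier M" and t_rel: "\<And>R xs. rel M R (map t xs) = rel M R xs"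
    using t by (simp_all add: autg_def)
  have t_inj: "inj t" using permutes_inj[OF t_perm] .
  have "\<exists>u\<in>autg (carrier M) (rel M). \<forall>x\<in>A \<union> B. u x = (t \<circ> (\<phi> \<circ> \<alpha>)) x"
  proof (rule homogeneous_M)
    show "finite (A \<union> B)" "A \<union> B \<subseteq> carrier M" using A B by simp_all
    show "inj_on (t \<circ> (\<phi> \<circ> \<alpha>)) (A \<union> B)"
      by (rule comp_inj_on[OF inj\<phi>\<alpha> inj_on_subset[OF t_inj]]) simp
    show "(t \<circ> (\<phi> \<circ> \<alpha>)) ` (A \<union> B) \<subseteq> carrier M"
      using \<phi>M D_carrier permutes_in_image[OF t_perm] by auto
    fix R xs assume "set xs \<subseteq> A \<union> B"
    then have "rel M R (map t (map (\<phi> \<circ> \<alpha>) xs)) = rel M R xs" using \<phi>\<alpha>_rel t_rel by metis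
    then show "rel M R (map (t \<circ> (\<phi> \<circ> \<alpha>)) xs) = rel M R xs" by simp
  qed
  then obtain u where u: "u \<in> autg (carrier M) (rel M)" and u_eq: "\<And>x. x \<in> A \<union> B \<Longrightarrow> u x = t (\<phi> (\<alpha> x))"
    by auto
  have uB: "u x = x" if "x \<in> B" for x using u_eq[of x] \<alpha>B[OF that] t\<gamma>[of x] that by simp
  have "free_indep (rel M) (u ` A) B C"
  proof (rule free_indepI)
    have "a \<in> B" if "a \<in> A" "u a \<in> C" for a
    proof -
      have "t (\<phi> (\<alpha> a)) = t (\<phi> (\<gamma> (u a)))" using u_eq[of a] t\<gamma>[of "u a"] that by simp
      then have "\<phi> (\<alpha> a) = \<phi> (\<gamma> (u a))" by (rule injD[OF t_inj])
      then have "\<alpha> a = \<gamma> (u a)" by (rule inj_onD[OF \<phi>_inj]) (use that D_carrier in auto)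
      then show ?thesis using \<alpha>\<gamma>[of a "u a"] that by blast
    qed
    then have "u a \<in> B" if "a \<in> A" "u a \<in> C" for a using uB[of a] that by metis
    then show "u ` A \<inter> C \<subseteq> B" by blast
    have uAB: "(t \<circ> \<phi>) ` \<alpha> ` (A \<union> B) = u ` A \<union> B"
    proof -
      have "(t \<circ> \<phi>) ` \<alpha> ` (A \<union> B) = u ` (A \<union> B)" unfolding image_image using u_eq by simp
      also have "\<dots> = u ` A \<union> B" using image_cong[OF refl uB, of B] by (simp add: image_Un)
      finally show ?thesis .
    qed
    have uBC: "(t \<circ> \<phi>) ` \<gamma> ` (B \<union> C) = B \<union> C" unfolding image_image using t\<gamma> by simp
    fix R xs assume xs: "rel M R xs" "set xs \<subseteq> u ` A \<union> B \<union> C" "\<not> set xs \<subseteq> u ` A \<union> B"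
    have "set xs \<subseteq> (t \<circ> \<phi>) ` carrier D" unfolding D_carrier image_Un[of "t \<circ> \<phi>"] uAB uBC using xs(2) by blast
    then obtain ds where ds: "set ds \<subseteq> carrier D" "xs = map (t \<circ> \<phi>) ds" using lift_list by metis
    then have "rel M R (map t (map \<phi> ds))" using xs(1) by simp
    then have "rel D R ds" using t_rel \<phi>_rel[OF ds(1)] by blast
    then have "set ds \<subseteq> \<alpha> ` (A \<union> B) \<or> set ds \<subseteq> \<gamma> ` (B \<union> C)" by (rule D_free)
    moreover have "set xs = (t \<circ> \<phi>) ` set ds" using ds(2) by simp
    ultimately have "set xs \<subseteq> u ` A \<union> B \<or> set xs \<subseteq> B \<union> C"
      using uAB uBC image_mono[of "set ds" _ "t \<circ> \<phi>"] by metis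
    then show "set xs \<subseteq> B \<union> C" using xs(3) by blast
  qed
  then show ?thesis using u uB by blast
qed

lemma transitive_free_homogeneous_M:
  assumes indisc: "\<not> indiscernible_set M"
    and trans: "transitive_action (Aut M) (carrier M) (\<lambda>g. g)"
  shows "transitive_free_homogeneous (carrier M) (rel M)"
proof -
  interpret free_homogeneous "carrier M" "rel M"
  proof
    show "countable (carrier M)" by (rule countable_M)
    show "set xs \<subseteq> carrier M" if "rel M R xs" for R xs
      using that structure_M by (simp add: structure_for_def)
    show "\<exists>g\<in>autg (carrier M) (rel M). \<forall>x\<in>S. g x = f x"
      if "finite S" "S \<subseteq> carrier M" "inj_on f S" "f ` S \<subseteq> carrier M"
        "\<And>R xs. set xs \<subseteq> S \<Longrightarrow> rel M R (map f xs) = rel M R xs" for S f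
      using that by (rule homogeneous_M)
    show "\<exists>u\<in>autg (carrier M) (rel M). (\<forall>x\<in>B. u x = x) \<and> free_indep (rel M) (u ` A) B C"
      if "finite A" "A \<subseteq> carrier M" "finite B" "B \<subseteq> carrier M" "finite C" "C \<subseteq> carrier M" for A B C
      using that by (rule free_extension_M)
  qed
  have trans': "\<exists>p\<in>G. p x = y" if xy: "x \<in> carrier M" "y \<in> carrier M" for x y
  proof -
    obtain g where g: "g \<in> carrier (Aut M)" "g x = y"
      using transitive_action.unique_orbit[OF trans xy] by blast
    obtain p where "p \<in> G" "p x = g x" using extend_Aut[OF structure_M g(1)] xy(1) by metis
    then show ?thesis using g(2) by blast
  qed
  show ?thesis
  proof
    show "\<exists>g\<in>G. g x = y" if "x \<in> carrier M" "y \<in> carrier M" for x y using trans' that .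
    show "\<exists>R xs. rel M R xs \<and> 2 \<le> card (set xs)"
    proof (rule ccontr)
      assume "\<not> ?thesis"
      \<comment> \<open>If every relation concerned at most one point, transitivity would make every
        permutation of the carrier an automorphism.\<close>
      then have unary: "card (set xs) \<le> 1" if "rel M R xs" for R xs
        using that by (metis One_nat_def not_less_eq_eq numeral_2_eq_2)
      have "struct_iso f M M" if f: "f \<in> Bij (carrier M)" for f
      proof -
        have bij: "bij_betw f (carrier M) (carrier M)" using f by (simp add: Bij_def)
        have "rel M R xs = rel M R (map f xs)" if xs: "set xs \<subseteq> carrier M" for R xs
        proof (cases "card (set xs) \<le> 1")
          case True
          have "f ` set xs \<subseteq> carrier M" using bij xs by (auto simp: bij_betw_def)
          from rl_degenerate[OF trans' xs this True] show ?thesis by blast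
        next
          case False
          have "card (set (map f xs)) = card (set xs)"
            using bij xs unfolding set_map bij_betw_def by (metis card_image inj_on_subset)
          then show ?thesis using False unary by metis
        qed
        then show ?thesis using bij by (simp add: struct_iso_def)
      qed
      then have "{f \<in> Bij (carrier M). struct_iso f M M} = Bij (carrier M)" by blast
      then have "Aut M = BijGroup (carrier M)" by (simp add: Aut_def BijGroup_def)
      then show False using indisc by (simp add: indiscernible_set_def)
    qed
  qed
qed

end

section \<open>Transfer to the group \<open>Aut M\<close>\<close>

lemma Aut_mult: "f \<in> carrier (Aut M) \<Longrightarrow> g \<in> carrier (Aut M) \<Longrightarrow> f \<otimes>\<^bsub>Aut M\<^esub> g = compose (carrier M) f g"
  by (simp add: Aut_def BijGroup_def)

lemma Aut_one: "\<one>\<^bsub>Aut M\<^esub> = (\<lambda>x\<in>carrier M. x)"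
  by (simp add: Aut_def BijGroup_def)

lemma restrict_comp:
  assumes "p \<in> autg (carrier M) (rel M)" "q \<in> autg (carrier M) (rel M)"
  shows "restrict (p \<circ> q) (carrier M) = restrict p (carrier M) \<otimes>\<^bsub>Aut M\<^esub> restrict q (carrier M)"
proof -
  have "q x \<in> carrier M \<longleftrightarrow> x \<in> carrier M" for x
    using assms(2) permutes_in_image[of q "carrier M" x] by (simp add: autg_def)
  then show ?thesis
    unfolding Aut_mult[OF restrict_autg[OF assms(1)] restrict_autg[OF assms(2)]]
    by (auto simp: compose_def restrict_def)
qed

lemma restrict_iv:
  assumes "p \<in> autg (carrier M) (rel M)" "iv p \<in> autg (carrier M) (rel M)"
  shows "restrict (iv p) (carrier M) = inv\<^bsub>Aut M\<^esub> restrict p (carrier M)"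
proof -
  interpret group "Aut M" by (rule group_Aut)
  have "iv p \<circ> p = id" using permutes_inv_o(2)[of p "carrier M"] assms(1) by (simp add: autg_def)
  then have "restrict (iv p) (carrier M) \<otimes>\<^bsub>Aut M\<^esub> restrict p (carrier M) = \<one>\<^bsub>Aut M\<^esub>"
    unfolding restrict_comp[OF assms(2,1), symmetric] Aut_one by (simp add: restrict_def id_def)
  then show ?thesis
    using inv_equality restrict_autg[OF assms(1)] restrict_autg[OF assms(2)] by metis
qed

theorem corollary5p2:
  fixes L :: "'r set" and ar :: "'r \<Rightarrow> nat"
    and \<C> :: "(nat, 'r) relstr set" and M :: "('a, 'r) relstr"
  assumes "free_amalgamation_class L ar \<C>"
    and "fraisse_limit L ar \<C> M"
    and "\<not> indiscernible_set M"
    and "transitive_action (Aut M) (carrier M) (\<lambda>g. g)"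
  shows "is_simple (Aut M) \<and>
    (\<forall>g\<in>carrier (Aut M). g \<noteq> \<one>\<^bsub>Aut M\<^esub> \<longrightarrow>
      (\<forall>h\<in>carrier (Aut M). \<exists>xs. length xs \<le> 16 \<and>
         set xs \<subseteq> conjugates (Aut M) g \<union> conjugates (Aut M) (inv\<^bsub>Aut M\<^esub> g) \<and>
         h = foldr (\<otimes>\<^bsub>Aut M\<^esub>) xs \<one>\<^bsub>Aut M\<^esub>))"
proof -
  interpret fraisse_limit_of_free_class L ar \<C> M
    using assms(1,2) by unfold_locales
  interpret transitive_free_homogeneous "carrier M" "rel M"
    by (rule transitive_free_homogeneous_M[OF assms(3,4)])
  interpret A: group "Aut M" by (rule group_Aut)
  let ?r = "\<lambda>p. restrict p (carrier M)"
  have restr_cj: "?r (cj p u) \<in> conjugates (Aut M) (?r p)" if p: "p \<in> G" and u: "u \<in> G" for p u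
  proof -
    \<comment> \<open>\<open>conjugates\<close> has the inverse on the right and \<open>cj\<close>
      on the left, so the witness comes from \<open>iv u\<close>.\<close>
    have iu: "iv u \<in> G" "iv u \<circ> p \<in> G" using p u by blast+
    have "?r (cj p u) = ?r (iv u) \<otimes>\<^bsub>Aut M\<^esub> ?r p \<otimes>\<^bsub>Aut M\<^esub> ?r u"
      unfolding cj_def restrict_comp[OF iu(2) u] restrict_comp[OF iu(1) p] by (rule refl)
    moreover have "?r u = inv\<^bsub>Aut M\<^esub> ?r (iv u)"
      using restrict_iv[of "iv u" M] iu(1) u inv_inv_G[OF u] by simp
    ultimately show ?thesis unfolding conjugates_def using restrict_autg[OF iu(1)] by auto
  qed
  have products: "\<exists>xs. length xs \<le> 16 \<and>
      set xs \<subseteq> conjugates (Aut M) g \<union> conjugates (Aut M) (inv\<^bsub>Aut M\<^esub> g) \<and>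
      h = foldr (\<otimes>\<^bsub>Aut M\<^esub>) xs \<one>\<^bsub>Aut M\<^esub>"
    if g: "g \<in> carrier (Aut M)" "g \<noteq> \<one>\<^bsub>Aut M\<^esub>" and h: "h \<in> carrier (Aut M)" for g h
  proof -
    obtain p where p: "p \<in> G" "?r p = g" using extend_Aut[OF structure_M g(1)] by metis
    obtain q where q: "q \<in> G" "?r q = h" using extend_Aut[OF structure_M h] by metis
    have id: "?r id = \<one>\<^bsub>Aut M\<^esub>" by (simp add: Aut_one restrict_def id_def)
    then have "p \<noteq> id" using p(2) g(2) by blast
    then obtain ps where ps: "q = foldr (\<circ>) ps id" "length ps = 16" "set ps \<subseteq> cj p ` G \<union> cj (iv p) ` G"
      using conj_products_16[OF p(1) _ q(1)] unfolding conj_products_def by blast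
    have ip: "iv p \<in> G" using p(1) by blast
    have psG: "set ps \<subseteq> G" using ps(3) cj_G p(1) ip by blast
    have "foldr (\<circ>) rs id \<in> G \<and> ?r (foldr (\<circ>) rs id) = foldr (\<otimes>\<^bsub>Aut M\<^esub>) (map ?r rs) \<one>\<^bsub>Aut M\<^esub>"
      if "set rs \<subseteq> G" for rs
      using that
    proof (induction rs)
      case Nil
      show ?case using id id_in by (metis foldr_Nil id_apply list.map(1))
    next
      case (Cons a rs)
      have "set rs \<subseteq> G" and a: "a \<in> G" using Cons.prems by auto
      note IH = conjunct1[OF Cons.IH[OF this(1)]] conjunct2[OF Cons.IH[OF this(1)]]
      have "a \<circ> foldr (\<circ>) rs id \<in> G" using a IH(1) by blast
      moreover have "?r (a \<circ> foldr (\<circ>) rs id) =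
          ?r a \<otimes>\<^bsub>Aut M\<^esub> foldr (\<otimes>\<^bsub>Aut M\<^esub>) (map ?r rs) \<one>\<^bsub>Aut M\<^esub>"
        unfolding restrict_comp[OF a IH(1)] IH(2) by (rule refl)
      moreover have "foldr (\<circ>) (a # rs) id = a \<circ> foldr (\<circ>) rs id" by simp
      moreover have "foldr (\<otimes>\<^bsub>Aut M\<^esub>) (map ?r (a # rs)) \<one>\<^bsub>Aut M\<^esub> =
          ?r a \<otimes>\<^bsub>Aut M\<^esub> foldr (\<otimes>\<^bsub>Aut M\<^esub>) (map ?r rs) \<one>\<^bsub>Aut M\<^esub>" by simp
      ultimately show ?case by argo
    qed
    then have "h = foldr (\<otimes>\<^bsub>Aut M\<^esub>) (map ?r ps) \<one>\<^bsub>Aut M\<^esub>" using psG q(2) ps(1) by blast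
    moreover have "set (map ?r ps) \<subseteq> conjugates (Aut M) g \<union> conjugates (Aut M) (inv\<^bsub>Aut M\<^esub> g)"
    proof -
      have *: "?r (cj p u) \<in> conjugates (Aut M) g" "?r (cj (iv p) u) \<in> conjugates (Aut M) (inv\<^bsub>Aut M\<^esub> g)"
        if "u \<in> G" for u
        using restr_cj[OF p(1) that] restr_cj[OF ip that] restrict_iv[OF p(1) ip] p(2) by simp_all
      have "set (map ?r ps) \<subseteq> ?r ` (cj p ` G \<union> cj (iv p) ` G)"
        unfolding set_map by (rule image_mono[OF ps(3)])
      also have "\<dots> \<subseteq> conjugates (Aut M) g \<union> conjugates (Aut M) (inv\<^bsub>Aut M\<^esub> g)"
        unfolding image_Un image_image using * by (intro Un_mono image_subsetI)
      finally show ?thesis .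
    qed
    moreover have "length (map ?r ps) \<le> 16" using ps(2) by simp
    ultimately show ?thesis by blast
  qed
  have "carrier (Aut M) \<noteq> {\<one>\<^bsub>Aut M\<^esub>}"
  proof
    assume trivial: "carrier (Aut M) = {\<one>\<^bsub>Aut M\<^esub>}"
    obtain R xs where xs: "rel M R xs" "2 \<le> card (set xs)" using nondegenerate by blast
    then obtain x y where xy: "x \<in> set xs" "y \<in> set xs" "x \<noteq> y"
      by (metis One_nat_def card_le_Suc0_iff_eq List.finite_set not_less_eq_eq numeral_2_eq_2)
    then have "x \<in> carrier M" "y \<in> carrier M" using rl_M[OF xs(1)] by blast+
    then obtain g where "g \<in> carrier (Aut M)" "g x = y"
      using transitive_action.unique_orbit[OF assms(4)] by blast
    then show False using trivial xy(3) \<open>x \<in> carrier M\<close> by (simp add: Aut_one)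
  qed
  moreover have "N = carrier (Aut M) \<or> N = {\<one>\<^bsub>Aut M\<^esub>}" if N: "N \<lhd> Aut M" for N
  proof (rule disjCI)
    assume "N \<noteq> {\<one>\<^bsub>Aut M\<^esub>}"
    interpret N: normal N "Aut M" by (rule N)
    obtain g where g: "g \<in> N" "g \<noteq> \<one>\<^bsub>Aut M\<^esub>" using \<open>N \<noteq> {\<one>\<^bsub>Aut M\<^esub>}\<close> N.one_closed by blast
    have conj: "conjugates (Aut M) x \<subseteq> N" if "x \<in> N" for x
      using N.inv_op_closed2 that unfolding conjugates_def by blast
    have "h \<in> N" if h: "h \<in> carrier (Aut M)" for h
    proof -
      obtain xs where xs: "set xs \<subseteq> conjugates (Aut M) g \<union> conjugates (Aut M) (inv\<^bsub>Aut M\<^esub> g)"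
        "h = foldr (\<otimes>\<^bsub>Aut M\<^esub>) xs \<one>\<^bsub>Aut M\<^esub>"
        using products[OF N.mem_carrier[OF g(1)] g(2) h] by blast
      then have "set xs \<subseteq> N" using conj g(1) N.m_inv_closed by blast
      then have "foldr (\<otimes>\<^bsub>Aut M\<^esub>) xs \<one>\<^bsub>Aut M\<^esub> \<in> N"
        by (induction xs) (auto intro: N.one_closed N.m_closed)
      then show ?thesis using xs(2) by simp
    qed
    then show "N = carrier (Aut M)" using N.subset by blast
  qed
  ultimately have "is_simple (Aut M)" unfolding is_simple_def using group_Aut by blast
  then show ?thesis using products by blast
qed

end
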